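(* For all constant values of $\mu\in(0,1)$ and all values of $d$ there exist constants $\epsilon>0$ and $\delta>0$ such that there is an algorithm for #OV$^{\mu,d}$ that runs in time $\tilde{O}(n^{2-\delta})$ and outputs the correct answer with probability at least $1-n^{-\epsilon}$.
   Context: #OV$^{\mu,d}$: the input is two lists of $n$ binary vectors of dimension $d$, where all $2nd$ bits are independent and each equals $1$ with probability $\mu$; the output is the number of pairs (one vector from each list) whose dot product is $0$. The probability is over the random input. *)

theory Defs
  imports
    "HOL-Probability.Probability"
    "HOL-Library.Landau_Symbols"
    "HOL-Library.Log_Nat"
begin

section \<open>A word RAM\<close>

text \<open>
  Programs are finite syntax trees over a word RAM with word length \<open>w\<close>: registers and memory cells
  hold words, i.e. numbers below \<open>2 ^ w\<close>; arithmetic is modulo \<open>2 ^ w\<close>; memory is addressed by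
  words. Control flow is structured. Every instruction and every test costs one unit of time.
\<close>

datatype binop =
  OpAdd | OpSub | OpMul | OpDiv | OpMod | OpAnd | OpOr | OpXor | OpShl | OpShr | OpLess | OpEq

fun word_op :: "nat \<Rightarrow> binop \<Rightarrow> nat \<Rightarrow> nat \<Rightarrow> nat" where
  "word_op w OpAdd x y = (x + y) mod 2 ^ w"
| "word_op w OpSub x y = (x + 2 ^ w - y) mod 2 ^ w"
| "word_op w OpMul x y = (x * y) mod 2 ^ w"
| "word_op w OpDiv x y = x div y"
| "word_op w OpMod x y = x mod y"
| "word_op w OpAnd x y = Bit_Operations.and x y"
| "word_op w OpOr x y = Bit_Operations.or x y"
| "word_op w OpXor x y = Bit_Operations.xor x y"
| "word_op w OpShl x y = push_bit y x mod 2 ^ w"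
| "word_op w OpShr x y = drop_bit y x"
| "word_op w OpLess x y = of_bool (x < y)"
| "word_op w OpEq x y = of_bool (x = y)"

type_synonym reg = nat

text \<open>Registers, then memory.\<close>

type_synonym state = "(reg \<Rightarrow> nat) \<times> (nat \<Rightarrow> nat)"

datatype com =
  Skip
| Const reg nat
| Op binop reg reg reg  \<comment> \<open>target register first\<close>
| Load reg reg  \<comment> \<open>\<open>Load r a\<close>: register \<open>r\<close> gets the cell addressed by register \<open>a\<close>\<close>
| Store reg reg  \<comment> \<open>\<open>Store a r\<close>: the cell addressed by register \<open>a\<close> gets register \<open>r\<close>\<close>
| Seq com com
| IfNZ reg com com
| WhileNZ reg com

text \<open>\<open>exec w P s t s'\<close>: on words of length \<open>w\<close>, the program \<open>P\<close> started in \<open>s\<close> halts in \<open>s'\<close> after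
  exactly \<open>t\<close> units of time.\<close>

inductive exec :: "nat \<Rightarrow> com \<Rightarrow> state \<Rightarrow> nat \<Rightarrow> state \<Rightarrow> bool" for w :: nat where
  Skip: "exec w Skip s 1 s"
| Const: "exec w (Const r k) (R, M) 1 (R(r := k mod 2 ^ w), M)"
| Op: "exec w (Op f r a b) (R, M) 1 (R(r := word_op w f (R a) (R b)), M)"
| Load: "exec w (Load r a) (R, M) 1 (R(r := M (R a)), M)"
| Store: "exec w (Store a r) (R, M) 1 (R, M(R a := R r))"
| Seq: "exec w P s t s' \<Longrightarrow> exec w Q s' u s'' \<Longrightarrow> exec w (Seq P Q) s (t + u) s''"
| IfTrue: "fst s r \<noteq> 0 \<Longrightarrow> exec w P s t s' \<Longrightarrow> exec w (IfNZ r P Q) s (1 + t) s'"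
| IfFalse: "fst s r = 0 \<Longrightarrow> exec w Q s t s' \<Longrightarrow> exec w (IfNZ r P Q) s (1 + t) s'"
| WhileFalse: "fst s r = 0 \<Longrightarrow> exec w (WhileNZ r P) s 1 s"
| WhileTrue: "fst s r \<noteq> 0 \<Longrightarrow> exec w P s t s' \<Longrightarrow> exec w (WhileNZ r P) s' u s'' \<Longrightarrow>
    exec w (WhileNZ r P) s (1 + t + u) s''"

inductive_cases exec_SkipE: "exec w Skip s t s'"
inductive_cases exec_ConstE: "exec w (Const r k) s t s'"
inductive_cases exec_OpE: "exec w (Op f r a b) s t s'"
inductive_cases exec_LoadE: "exec w (Load r a) s t s'"
inductive_cases exec_StoreE: "exec w (Store a r) s t s'"
inductive_cases exec_SeqE: "exec w (Seq P Q) s t s'"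
inductive_cases exec_IfE: "exec w (IfNZ r P Q) s t s'"
inductive_cases exec_WhileE: "exec w (WhileNZ r P) s t s'"

lemma exec_deterministic:
  "exec w P s t s1 \<Longrightarrow> exec w P s u s2 \<Longrightarrow> u = t \<and> s2 = s1"
proof (induction arbitrary: u s2 rule: exec.induct)
  case (Seq P s t s' Q v s'')
  from Seq.prems obtain t1 r t2 where *: "u = t1 + t2" "exec w P s t1 r" "exec w Q r t2 s2"
    by (rule exec_SeqE) (rule that)
  from Seq.IH(1)[OF *(2)] have "t1 = t" "r = s'" by simp_all
  with *(3) Seq.IH(2)[of t2 s2] *(1) show ?case by simp
next
  case (IfTrue s r P t s' Q)
  from IfTrue.prems show ?case
  proof (rule exec_IfE)
    fix t' assume "u = Suc t'" "exec w P s t' s2"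
    with IfTrue.IH[of t' s2] show ?thesis by simp
  qed (use IfTrue.hyps(1) in simp)
next
  case (IfFalse s r Q t s' P)
  from IfFalse.prems show ?case
  proof (rule exec_IfE)
    fix t' assume "u = Suc t'" "exec w Q s t' s2"
    with IfFalse.IH[of t' s2] show ?thesis by simp
  qed (use IfFalse.hyps(1) in simp)
next
  case (WhileFalse s r P)
  from WhileFalse.prems show ?case
    by (rule exec_WhileE) (use WhileFalse.hyps(1) in simp_all)
next
  case (WhileTrue s r P t s' v s'')
  from WhileTrue.prems show ?case
  proof (rule exec_WhileE)
    fix t1 q t2 assume *: "u = Suc (t1 + t2)" "exec w P s t1 q" "exec w (WhileNZ r P) q t2 s2"
    from WhileTrue.IH(1)[OF *(2)] have "t1 = t" "q = s'" by simp_all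
    with *(3) WhileTrue.IH(2)[of t2 s2] *(1) show ?thesis by simp
  qed (use WhileTrue.hyps(1) in simp)
qed (erule exec_SkipE exec_ConstE exec_OpE exec_LoadE exec_StoreE; simp)+

lemma word_op_less:
  assumes x: "x < 2 ^ w" and y: "y < 2 ^ w" and w: "w > 0"
  shows "word_op w f x y < 2 ^ w"
proof -
  have dm: "x div y < 2 ^ w" "x mod y < 2 ^ w" "x div 2 ^ y < 2 ^ w"
    by (rule le_less_trans[OF div_le_dividend x] le_less_trans[OF mod_less_eq_dividend x])+
  have one: "(1::nat) < 2 ^ w"
    using w by (intro one_less_power) simp_all
  have tx: "take_bit w x = x" and ty: "take_bit w y = y"
    using x y by (simp_all only: take_bit_nat_eq_self_iff)
  have bits: "Bit_Operations.and x y < 2 ^ w" "Bit_Operations.or x y < 2 ^ w"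
      "Bit_Operations.xor x y < 2 ^ w"
    by (simp_all only: take_bit_nat_eq_self_iff[symmetric] take_bit_and take_bit_or take_bit_xor tx ty)
  show ?thesis
    using dm one bits by (cases f) (simp_all only: word_op.simps drop_bit_eq_div of_bool_def mod_less_divisor
      zero_less_power zero_less_numeral split: if_split, simp_all)
qed

lemma exec_words:
  assumes "exec w P s t s'" "w > 0" "\<forall>i. fst s i < 2 ^ w" "\<forall>i. snd s i < 2 ^ w"
  shows "(\<forall>i. fst s' i < 2 ^ w) \<and> (\<forall>i. snd s' i < 2 ^ w)"
  using assms
proof (induction rule: exec.induct)
  case (Op f r a b R M)
  then have "word_op w f (R a) (R b) < 2 ^ w"
    by (intro word_op_less) simp_all
  with Op show ?case by simp
qed simp_all

definition load_input :: "nat list \<Rightarrow> state" where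
  "load_input xs = (\<lambda>_. 0, \<lambda>a. if a < length xs then xs ! a else 0)"


section \<open>Counting orthogonal vectors\<close>

type_synonym bvec = "bool list"

definition dot :: "bvec \<Rightarrow> bvec \<Rightarrow> nat" where
  "dot u v = (\<Sum>k<length u. of_bool (u ! k) * of_bool (v ! k))"

definition sharp_OV :: "bvec list \<Rightarrow> bvec list \<Rightarrow> nat" where
  "sharp_OV A B = card {(i, j). i < length A \<and> j < length B \<and> dot (A ! i) (B ! j) = 0}"

definition ov_instances :: "nat \<Rightarrow> nat \<Rightarrow> (bvec list \<times> bvec list) set" where
  "ov_instances n d =
     (let L = {A. length A = n \<and> (\<forall>v \<in> set A. length v = d)} in L \<times> L)"

definition random_ov :: "real \<Rightarrow> nat \<Rightarrow> nat \<Rightarrow> (bvec list \<times> bvec list) pmf" where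
  "random_ov \<mu> n d =
     (let L = replicate_pmf n (replicate_pmf d (bernoulli_pmf \<mu>)) in pair_pmf L L)"

text \<open>The memory image of an instance: \<open>n\<close>, \<open>d\<close>, then the bits of both lists, vector by vector,
  one bit per word.\<close>

definition ov_input :: "nat \<Rightarrow> nat \<Rightarrow> bvec list \<times> bvec list \<Rightarrow> nat list" where
  "ov_input n d I = n # d # map of_bool (concat (fst I) @ concat (snd I))"

text \<open>Words of \<open>c * O(log N)\<close> bits, where \<open>N = 2 * (n + 1) * (d + 1)\<close> bounds the number of input words
  and the numbers \<open>n\<close> and \<open>d\<close>; for \<open>c \<ge> 1\<close> the input fits and is addressable.\<close>

definition word_length :: "nat \<Rightarrow> nat \<Rightarrow> nat \<Rightarrow> nat" where
  "word_length c n d = c * floorlog 2 (2 * (n + 1) * (d + 1))"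

definition halts_within :: "nat \<Rightarrow> com \<Rightarrow> nat list \<Rightarrow> nat \<Rightarrow> bool" where
  "halts_within w P xs T \<longleftrightarrow> (\<exists>t s. exec w P (load_input xs) t s \<and> t \<le> T)"

text \<open>The output is the content of register 0 on halting.\<close>

definition outputs :: "nat \<Rightarrow> com \<Rightarrow> nat list \<Rightarrow> nat \<Rightarrow> bool" where
  "outputs w P xs y \<longleftrightarrow> (\<exists>t s. exec w P (load_input xs) t s \<and> fst s 0 = y)"

definition soft_O :: "(nat \<Rightarrow> real) \<Rightarrow> (nat \<Rightarrow> real) set" where
  "soft_O g = {f. \<exists>k::nat. f \<in> O(\<lambda>n. g n * ln (real n) ^ k)}"

end

theory Submission
  imports Defs
begin

text \<open>
  Let \<open>\<rho> = 1 - \<mu>\<^sup>2\<close>, so that two random vectors are orthogonal on \<open>k\<close> fixed coordinates with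
  probability \<open>\<rho> ^ k\<close>, and let \<open>L\<close> be the bit length of \<open>n\<close>. If \<open>d\<close> exceeds a large multiple of \<open>L\<close>,
  the expected number of orthogonal pairs is at most \<open>n powr (- \<epsilon>)\<close>, so the answer is \<open>0\<close> with the
  required probability. Otherwise every vector fits into one machine word and orthogonality is a
  single bitwise conjunction. Put \<open>k = L div 2\<close>. For each of the roughly \<open>sqrt n\<close> prefixes \<open>p\<close> of
  length \<open>k\<close>, collect the vectors of the second list that are orthogonal to \<open>p\<close>, and compare them with
  the vectors of the first list that have prefix \<open>p\<close>. The pairs compared are those orthogonal on the
  first \<open>k\<close> coordinates, on average \<open>n\<^sup>2 * \<rho> ^ k\<close> many if \<open>k \<le> d\<close>. By Markov's inequality their number
  exceeds a budget of \<open>n\<^sup>2 / n powr \<delta>\<close> only with polynomially small probability.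

  Once the budget is exhausted the program counts all remaining candidate pairs as orthogonal without
  comparing them. This bounds the running time on every input, and it is still correct if \<open>d \<le> k\<close>,
  where being orthogonal on the prefix is being orthogonal; so small \<open>d\<close> needs no separate treatment.
\<close>

section \<open>Weakest preconditions with time\<close>

text \<open>Total correctness: a halting run is asserted, so termination comes with every such
  claim. The elapsed time is an argument of the postcondition, so one pass over the program settles
  both result and cost.\<close>

definition wp :: "nat \<Rightarrow> com \<Rightarrow> (nat \<Rightarrow> (reg \<Rightarrow> nat) \<Rightarrow> (nat \<Rightarrow> nat) \<Rightarrow> bool) \<Rightarrow>
    (reg \<Rightarrow> nat) \<Rightarrow> (nat \<Rightarrow> nat) \<Rightarrow> bool" where
  "wp w P Q R M \<longleftrightarrow> (\<exists>t R' M'. exec w P (R, M) t (R', M') \<and> Q t R' M')"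

lemma wp_Skip [simp]: "wp w Skip Q R M \<longleftrightarrow> Q 1 R M"
  unfolding wp_def using exec.Skip[of w "(R, M)"] by (auto elim: exec_SkipE)

lemma wp_Const [simp]: "wp w (Const r k) Q R M \<longleftrightarrow> Q 1 (R(r := k mod 2 ^ w)) M"
  unfolding wp_def using exec.Const[of w r k R M] by (auto elim: exec_ConstE)

lemma wp_Op [simp]: "wp w (Op f r a b) Q R M \<longleftrightarrow> Q 1 (R(r := word_op w f (R a) (R b))) M"
  unfolding wp_def using exec.Op[of w f r a b R M] by (auto elim: exec_OpE)

lemma wp_Load [simp]: "wp w (Load r a) Q R M \<longleftrightarrow> Q 1 (R(r := M (R a))) M"
  unfolding wp_def using exec.Load[of w r a R M] by (auto elim: exec_LoadE)

lemma wp_Store [simp]: "wp w (Store a r) Q R M \<longleftrightarrow> Q 1 R (M(R a := R r))"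
  unfolding wp_def using exec.Store[of w a r R M] by (auto elim: exec_StoreE)

text \<open>As a rewrite rule this moves the second program into the postcondition of the first, so
  the simplifier executes straight-line code symbolically and adds up the time.\<close>

lemma wp_Seq [simp]:
  "wp w (Seq P P') Q R M \<longleftrightarrow> wp w P (\<lambda>t. wp w P' (\<lambda>u. Q (t + u))) R M"
  unfolding wp_def by (fastforce intro: exec.intros elim: exec_SeqE)

lemma wp_If [simp]:
  "wp w (IfNZ r P P') Q R M \<longleftrightarrow>
    (if R r \<noteq> 0 then wp w P (\<lambda>t. Q (1 + t)) R M else wp w P' (\<lambda>t. Q (1 + t)) R M)"
  unfolding wp_def using exec.IfTrue[of "(R, M)" r w P _ _ P'] exec.IfFalse[of "(R, M)" r w P' _ _ P]
  by (auto elim!: exec_IfE) force+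

lemma wp_cons:
  assumes "wp w P Q R M" "\<And>t R' M'. Q t R' M' \<Longrightarrow> Q' t R' M'"
  shows "wp w P Q' R M"
  using assms unfolding wp_def by blast

text \<open>Induction on the index \<open>i\<close> of the invariant, the number of iterations left.
  The invariant also carries the time \<open>t\<close> spent so far; each iteration pays one unit
  for its test, and the final failing test gives \<open>t + 1\<close> on exit.\<close>

lemma wp_While:
  assumes init: "I m 0 R M"
    and test: "\<And>i t R M. I i t R M \<Longrightarrow> R r = 0 \<longleftrightarrow> i = 0"
    and step: "\<And>i t R M. I (Suc i) t R M \<Longrightarrow> wp w P (\<lambda>u. I i (t + u + 1)) R M"
    and exit: "\<And>t R M. I 0 t R M \<Longrightarrow> Q (t + 1) R M"
  shows "wp w (WhileNZ r P) Q R M"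
proof -
  have "wp w (WhileNZ r P) (\<lambda>u. Q (t + u)) R M" if "I m t R M" for t
    using that
  proof (induction m arbitrary: t R M)
    case 0
    then show ?case
      using test[OF 0] exit[OF 0] exec.WhileFalse[of "(R, M)" r w P] unfolding wp_def by fastforce
  next
    case (Suc m)
    from step[OF Suc.prems] obtain u R' M' where
      u: "exec w P (R, M) u (R', M')" "I m (t + u + 1) R' M'" unfolding wp_def by blast
    from Suc.IH[OF u(2)] obtain v R'' M'' where
      v: "exec w (WhileNZ r P) (R', M') v (R'', M'')" "Q (t + u + 1 + v) R'' M''"
      unfolding wp_def by blast
    have "exec w (WhileNZ r P) (R, M) (1 + u + v) (R'', M'')"
      using test[OF Suc.prems] u(1) v(1) by (intro exec.WhileTrue) auto
    moreover have "t + (1 + u + v) = t + u + 1 + v" by simp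
    ultimately show ?case using v(2) unfolding wp_def by metis
  qed
  from this[OF init] show ?thesis by simp
qed

section \<open>The program\<close>

notation Seq (infixr ";;" 60)

text \<open>
  \<open>rL\<close> holds \<open>L\<close> and \<open>rK\<close> holds \<open>k\<close>; \<open>rCap\<close> holds the budget plus one. The codes of the two lists are
  stored from addresses \<open>rX\<close> and \<open>rB\<close> on, behind the input, and the \<open>rM\<close> codes collected for the
  prefix \<open>rP\<close> from \<open>rY\<close> on. \<open>rS\<close> counts the candidate pairs seen so far.
\<close>

abbreviation (input) "rAns \<equiv> 0 :: reg"
abbreviation (input) "rOne \<equiv> 1 :: reg"
abbreviation (input) "rN \<equiv> 2 :: reg"
abbreviation (input) "rD \<equiv> 3 :: reg"
abbreviation (input) "rL \<equiv> 4 :: reg"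
abbreviation (input) "rU \<equiv> 5 :: reg"
abbreviation (input) "rK \<equiv> 6 :: reg"
abbreviation (input) "rMask \<equiv> 7 :: reg"
abbreviation (input) "rCap \<equiv> 8 :: reg"
abbreviation (input) "rX \<equiv> 9 :: reg"
abbreviation (input) "rB \<equiv> 10 :: reg"
abbreviation (input) "rY \<equiv> 11 :: reg"
abbreviation (input) "rP \<equiv> 12 :: reg"
abbreviation (input) "rM \<equiv> 13 :: reg"
abbreviation (input) "rI \<equiv> 14 :: reg"
abbreviation (input) "rJ \<equiv> 15 :: reg"
abbreviation (input) "rA \<equiv> 16 :: reg"
abbreviation (input) "rS \<equiv> 17 :: reg"
abbreviation (input) "rV \<equiv> 18 :: reg"
abbreviation (input) "rT \<equiv> 19 :: reg"
abbreviation (input) "rTwo \<equiv> 20 :: reg"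

abbreviation (input) "copy r a \<equiv> Op OpOr r a a"
abbreviation (input) "dec r \<equiv> Op OpSub r r rOne"

definition log_loop :: com where
  "log_loop = WhileNZ rU (Op OpShr rU rU rOne ;; Op OpAdd rL rL rOne)"

text \<open>Coordinates are read from the last to the first, so that repeated doubling makes
  coordinate \<open>s\<close> the bit \<open>s\<close> of the word.\<close>

definition read_loop :: com where
  "read_loop = WhileNZ rJ
    (dec rJ ;; Op OpAdd rT rP rJ ;; Load rT rT ;; Op OpAdd rV rV rV ;; Op OpAdd rV rV rT)"

text \<open>The input holds both lists consecutively, so one loop over \<open>2 * n\<close> vectors
  encodes both. Here \<open>rP\<close> is the address of the current vector.\<close>

definition encode_loop :: com where
  "encode_loop = WhileNZ rI
    (dec rI ;; Op OpMul rP rI rD ;; Op OpAdd rP rP rTwo ;; Const rV 0 ;; copy rJ rD ;; read_loop ;;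
     Op OpAdd rT rX rI ;; Store rT rV)"

definition bucket_loop :: com where
  "bucket_loop = WhileNZ rJ
    (dec rJ ;; Op OpAdd rT rB rJ ;; Load rV rT ;; Op OpAnd rT rV rP ;;
     IfNZ rT Skip (Op OpAdd rT rY rM ;; Store rT rV ;; Op OpAdd rM rM rOne))"

definition count_loop :: com where
  "count_loop = WhileNZ rJ
    (dec rJ ;; Op OpAdd rT rY rJ ;; Load rT rT ;; Op OpAnd rT rA rT ;;
     IfNZ rT Skip (Op OpAdd rAns rAns rOne))"

text \<open>\<open>rS\<close> is charged with the whole bucket before the budget is tested; after an
  overdraft the bucket is added to the answer unseen, at constant cost.\<close>

definition scan_loop :: com where
  "scan_loop = WhileNZ rI
    (dec rI ;; Op OpAdd rT rX rI ;; Load rA rT ;; Op OpAnd rT rA rMask ;; Op OpEq rT rT rP ;;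
     IfNZ rT
       (Op OpAdd rS rS rM ;; Op OpLess rT rS rCap ;;
        IfNZ rT (copy rJ rM ;; count_loop) (Op OpAdd rAns rAns rM))
       Skip)"

definition prefix_loop :: com where
  "prefix_loop = WhileNZ rP
    (dec rP ;; Const rM 0 ;; copy rJ rN ;; bucket_loop ;; copy rI rN ;; scan_loop)"

text \<open>\<open>rX\<close> is the first address behind the input; the codes of the two lists and
  then the bucket follow. The increment of \<open>rCap\<close> turns the strict test of
  \<open>OpLess\<close> into "at most the budget".\<close>

definition init_com :: "nat \<Rightarrow> com" where
  "init_com r =
    (Const rTwo 2 ;; Op OpDiv rK rL rTwo ;; Op OpShl rMask rOne rK ;; dec rMask ;;
     Const rT r ;; Op OpDiv rT rK rT ;; Op OpMul rCap rN rN ;; Op OpShr rCap rCap rT ;;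
     Op OpAdd rCap rCap rOne ;;
     Op OpAdd rI rN rN ;; Op OpMul rX rI rD ;; Op OpAdd rX rX rTwo ;;
     Op OpAdd rB rX rN ;; Op OpAdd rY rB rN)"

text \<open>Registers start at 0, so \<open>rAns\<close> is the address of \<open>n\<close>, and
  \<open>rOne\<close> is that of \<open>d\<close>. If \<open>d\<close> exceeds \<open>C * L\<close>,
  the answer register simply keeps its 0.\<close>

definition ov_prog :: "nat \<Rightarrow> nat \<Rightarrow> com" where
  "ov_prog C r =
    (Const rOne 1 ;; Load rN rAns ;; Load rD rOne ;; copy rU rN ;; log_loop ;;
     Const rT C ;; Op OpMul rT rT rL ;; Op OpLess rT rT rD ;;
     IfNZ rT Skip (init_com r ;; encode_loop ;; Op OpShl rP rOne rK ;; prefix_loop))"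

section \<open>Correctness and running time\<close>

lemma pred_mod:
  fixes i W :: nat
  assumes "Suc i < W"
  shows "(i + W) mod W = i" "(Suc i + W - Suc 0) mod W = i"
  using assms by simp_all

section \<open>Bit length of n and packing of vectors into words\<close>

lemma wp_log_loop:
  assumes "R rOne = 1" "R rL + floorlog 2 (R rU) < 2 ^ w"
  shows "wp w log_loop (\<lambda>t R' M'. M' = M \<and> t = 3 * floorlog 2 (R rU) + 1 \<and>
    R' rL = R rL + floorlog 2 (R rU) \<and> (\<forall>x. x \<notin> {rU, rL} \<longrightarrow> R' x = R x)) R M"
  unfolding log_loop_def
proof (rule wp_While[where m = "floorlog 2 (R rU)" and I = "\<lambda>i t R' M'. M' = M \<and>
    i = floorlog 2 (R' rU) \<and> t + 3 * i = 3 * floorlog 2 (R rU) \<and>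
    R' rL + i = R rL + floorlog 2 (R rU) \<and> (\<forall>x. x \<notin> {rU, rL} \<longrightarrow> R' x = R x)"], goal_cases)
  case (3 i t R' M')
  then have "R' rU > 0" by (cases "R' rU = 0") (auto simp: floorlog_def)
  then have "i = floorlog 2 (R' rU div 2)"
    using 3 compute_floorlog[of 2 "R' rU"] by simp
  with 3 assms show ?case by (auto simp: drop_bit_eq_div)
qed (auto simp: floorlog_eq_zero_iff)

abbreviation code :: "bvec \<Rightarrow> nat" where
  "code v \<equiv> horner_sum of_bool 2 v"

lemma code_less: "code v < 2 ^ length v"
  using horner_sum_of_bool_2_less[of v, where ?'a = nat] by simp

lemma wp_read_loop:
  assumes "R rOne = 1" "R rJ = length v" "R rV = 0"
    "\<And>s. s < length v \<Longrightarrow> M (R rP + s) = of_bool (v ! s)"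
    "R rP + length v < 2 ^ w" "length v < w"
  shows "wp w read_loop (\<lambda>t R' M'. M' = M \<and> t = 6 * length v + 1 \<and> R' rV = code v \<and>
    (\<forall>x. x \<notin> {rJ, rT, rV} \<longrightarrow> R' x = R x)) R M"
  unfolding read_loop_def
proof (rule wp_While[where m = "length v" and I = "\<lambda>i t R' M'. M' = M \<and> i \<le> length v \<and>
    R' rJ = i \<and> t + 6 * i = 6 * length v \<and> R' rV = code (drop i v) \<and>
    (\<forall>x. x \<notin> {rJ, rT, rV} \<longrightarrow> R' x = R x)"], goal_cases)
  case (3 i t R' M')
  \<comment> \<open>The partial code has fewer than \<open>w\<close> bits, so doubling and adding do
    not wrap around.\<close>
  have "code (drop i v) < 2 ^ (length v - i)" using code_less[of "drop i v"] by simp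
  also have "\<dots> < 2 ^ w" using assms(6) by simp
  finally have "code (drop i v) < 2 ^ w" .
  moreover have "drop i v = v ! i # drop (Suc i) v" using 3 by (simp add: Cons_nth_drop_Suc)
  ultimately have *: "of_bool (v ! i) + 2 * code (drop (Suc i) v) < 2 ^ w"
     "code (drop i v) = of_bool (v ! i) + 2 * code (drop (Suc i) v)" by simp_all
  then have "code (drop (Suc i) v) + code (drop (Suc i) v) < 2 ^ w" by simp
  with 3 assms * show ?case by (auto simp: pred_mod mult_2)
qed (use assms in auto)

lemma wp_encode_loop:
  fixes V :: "bvec list"
  assumes "R rOne = 1" "R rTwo = 2" "R rI = length V" "R rX = 2 + length V * R rD"
    "R rX + length V < 2 ^ w" "R rD < w"
    and len: "\<And>i. i < length V \<Longrightarrow> length (V ! i) = R rD"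
    and mem: "\<And>i s. i < length V \<Longrightarrow> s < R rD \<Longrightarrow> M (2 + i * R rD + s) = of_bool (V ! i ! s)"
  shows "wp w encode_loop (\<lambda>t R' M'. t = (6 * R rD + 9) * length V + 1 \<and>
    (\<forall>i < length V. M' (R rX + i) = code (V ! i)) \<and>
    (\<forall>x. x \<notin> {rI, rP, rV, rJ, rT} \<longrightarrow> R' x = R x)) R M"
  unfolding encode_loop_def
proof (rule wp_While[where m = "length V" and I = "\<lambda>i t R' M'. i \<le> length V \<and> R' rI = i \<and>
    t + (6 * R rD + 9) * i = (6 * R rD + 9) * length V \<and>
    (\<forall>j. i \<le> j \<and> j < length V \<longrightarrow> M' (R rX + j) = code (V ! j)) \<and>
    (\<forall>a < R rX. M' a = M a) \<and>
    (\<forall>x. x \<notin> {rI, rP, rV, rJ, rT} \<longrightarrow> R' x = R x)"], goal_cases)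
  case (3 i t R' M')
  \<comment> \<open>Vector \<open>i\<close> ends before \<open>rX\<close>, and the invariant
    preserves all cells below \<open>rX\<close>; hence writing codes destroys no unread
    input.\<close>
  have "Suc i * R rD \<le> length V * R rD" using 3 by (intro mult_right_mono) auto
  then have le: "R rD + i * R rD \<le> length V * R rD" by simp
  have mem': "M' (2 + i * R rD + s) = of_bool (V ! i ! s)" if "s < R rD" for s
    using that mem[of i s] 3 le assms(4) by simp
  show ?case
    using 3 assms(1-6) le
    apply (simp add: pred_mod)
    apply (rule wp_cons[OF wp_read_loop[where v = "V ! i"]])
    using mem' len[of i]
          apply (simp_all add: add.commute add.left_commute)
    done
qed (use assms in auto)

section \<open>Processing a single prefix: collecting, comparing, scanning\<close>

lemma wp_bucket_loop:
  assumes "R rOne = 1" "R rJ = length bl" "R rM = 0"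
    and mem: "\<And>j. j < length bl \<Longrightarrow> M (R rB + j) = bl ! j"
    and "R rB + length bl \<le> R rY" "R rY + length bl < 2 ^ w"
  defines "bs \<equiv> rev (filter (\<lambda>b. Bit_Operations.and b (R rP) = 0) bl)"
  shows "wp w bucket_loop (\<lambda>t R' M'. t \<le> 9 * length bl + 1 \<and>
    R' rM = length bs \<and> (\<forall>q < length bs. M' (R rY + q) = bs ! q) \<and> (\<forall>a < R rY. M' a = M a) \<and>
    (\<forall>x. x \<notin> {rJ, rT, rV, rM} \<longrightarrow> R' x = R x)) R M"
proof -
  \<comment> \<open>\<open>F i\<close> is the bucket after positions \<open>i\<close> and above have
    been treated; the downward traversal appends earlier positions later, hence the
    reversal.\<close>
  define F where "F i = rev (filter (\<lambda>b. Bit_Operations.and b (R rP) = 0) (drop i bl))" for i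
  have F: "F i = (if Bit_Operations.and (bl ! i) (R rP) = 0 then F (Suc i) @ [bl ! i] else F (Suc i))"
    if "i < length bl" for i
    using that Cons_nth_drop_Suc[OF that, symmetric] by (simp add: F_def)
  have len: "length (F i) \<le> length bl - i" for i
    unfolding F_def by (simp, rule order_trans[OF length_filter_le]) simp
  show ?thesis
    unfolding bucket_loop_def
  proof (rule wp_While[where m = "length bl" and I = "\<lambda>i t R' M'. i \<le> length bl \<and> R' rJ = i \<and>
      t + 9 * i \<le> 9 * length bl \<and> R' rM = length (F i) \<and>
      (\<forall>q < length (F i). M' (R rY + q) = F i ! q) \<and> (\<forall>a < R rY. M' a = M a) \<and>
      (\<forall>x. x \<notin> {rJ, rT, rV, rM} \<longrightarrow> R' x = R x)"], goal_cases)
    case (3 i t R' M')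
    then have "i < length bl" by simp
    moreover have "M' (R rB + i) = bl ! i" using 3 assms(5) mem[of i] by simp
    ultimately show ?case
      using 3 assms(1-3,5,6) len[of "Suc i"]
      by (auto simp: pred_mod F[of i] nth_append less_Suc_eq)
  next
    case (4 t R' M')
    then show ?case by (simp add: F_def bs_def)
  qed (use assms in \<open>auto simp: F_def\<close>)
qed

lemma wp_count_loop:
  assumes "R rOne = 1" "R rJ = length bs" "\<And>q. q < length bs \<Longrightarrow> M (R rY + q) = bs ! q"
    "R rY + length bs < 2 ^ w" "R rAns + length bs < 2 ^ w"
  shows "wp w count_loop (\<lambda>t R' M'. M' = M \<and> t \<le> 7 * length bs + 1 \<and>
    R' rAns = R rAns + length (filter (\<lambda>b. Bit_Operations.and (R rA) b = 0) bs) \<and>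
    (\<forall>x. x \<notin> {rJ, rT, rAns} \<longrightarrow> R' x = R x)) R M"
proof -
  define F where "F i = length (filter (\<lambda>b. Bit_Operations.and (R rA) b = 0) (drop i bs))" for i
  have F: "F i = (if Bit_Operations.and (R rA) (bs ! i) = 0 then Suc (F (Suc i)) else F (Suc i))"
    if "i < length bs" for i
    using that Cons_nth_drop_Suc[OF that, symmetric] by (simp add: F_def)
  have len: "F i \<le> length bs - i" for i
    unfolding F_def by (rule order_trans[OF length_filter_le]) simp
  show ?thesis
    unfolding count_loop_def
  proof (rule wp_While[where m = "length bs" and I = "\<lambda>i t R' M'. M' = M \<and> i \<le> length bs \<and>
      R' rJ = i \<and> t + 7 * i \<le> 7 * length bs \<and> R' rAns = R rAns + F i \<and>
      (\<forall>x. x \<notin> {rJ, rT, rAns} \<longrightarrow> R' x = R x)"], goal_cases)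
    case (3 i t R' M')
    then have "i < length bs" by simp
    then show ?case
      using 3 assms len[of "Suc i"] by (auto simp: pred_mod F[of i])
  next
    case (4 t R' M')
    then show ?case by (simp add: F_def)
  qed (use assms in \<open>auto simp: F_def\<close>)
qed

text \<open>
  The comparisons of \<open>count_loop\<close> are paid for by the increase of \<open>min S cap\<close>.
\<close>

lemma wp_scan_loop:
  fixes al bs :: "nat list"
  assumes "R rOne = 1" "R rI = length al" "R rM = length bs" "R rCap = Suc cap"
    and memA: "\<And>i. i < length al \<Longrightarrow> M (R rX + i) = al ! i"
    and memB: "\<And>q. q < length bs \<Longrightarrow> M (R rY + q) = bs ! q"
    and "R rX + length al < 2 ^ w" "R rY + length bs < 2 ^ w" "R rAns \<le> R rS"
  defines "g \<equiv> \<lambda>a. length (filter (\<lambda>b. Bit_Operations.and a b = 0) bs)"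
  defines "sel \<equiv> \<lambda>a. Bit_Operations.and a (R rMask) = R rP"
  defines "S \<equiv> R rS + (\<Sum>a\<leftarrow>al. if sel a then length bs else 0)"
  assumes "S < 2 ^ w"
  shows "wp w scan_loop (\<lambda>t R' M'. M' = M \<and> R' rS = S \<and> R' rAns \<le> S \<and>
    (S \<le> cap \<or> (\<forall>a \<in> set al. sel a \<longrightarrow> g a = length bs) \<longrightarrow>
      R' rAns = R rAns + (\<Sum>a\<leftarrow>al. if sel a then g a else 0)) \<and>
    t + 7 * min (R rS) cap \<le> 12 * length al + 7 * min S cap + 1 \<and>
    (\<forall>x. x \<notin> {rI, rT, rA, rS, rJ, rAns} \<longrightarrow> R' x = R x)) R M"
proof -
  define V where "V i = (\<Sum>a\<leftarrow>drop i al. if sel a then length bs else 0)" for i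
  define H where "H i = (\<Sum>a\<leftarrow>drop i al. if sel a then g a else 0)" for i
  have V: "V i = (if sel (al ! i) then length bs + V (Suc i) else V (Suc i))"
    and H: "H i = (if sel (al ! i) then g (al ! i) + H (Suc i) else H (Suc i))"
    if "i < length al" for i
    using that Cons_nth_drop_Suc[OF that, symmetric] by (simp_all add: V_def H_def)
  have V0: "S = R rS + V 0" by (simp add: S_def V_def)
  have VS: "R rS + V i \<le> S" for i
    using sum_list_append[of "map (\<lambda>a. if sel a then length bs else 0) (take i al)"
        "map (\<lambda>a. if sel a then length bs else 0) (drop i al)"]
    unfolding V0 V_def by (simp flip: map_append)
  \<comment> \<open>In either alternative the answer is exact: the budget is never exceeded, or
    every bucket added unseen consists of orthogonal partners only.\<close>
  define good where "good \<longleftrightarrow> S \<le> cap \<or> (\<forall>a \<in> set al. sel a \<longrightarrow> g a = length bs)"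
  have g: "g a \<le> length bs" for a unfolding g_def by (rule length_filter_le)
  have g_eq: "length (filter (\<lambda>b. Bit_Operations.and a b = 0) bs) = g a" for a
    by (simp add: g_def)
  show ?thesis
    unfolding scan_loop_def good_def[symmetric]
  proof (rule wp_While[where m = "length al" and I = "\<lambda>i t R' M'. M' = M \<and> i \<le> length al \<and>
      R' rI = i \<and> R' rS = R rS + V i \<and> R' rAns \<le> R' rS \<and> (good \<longrightarrow> R' rAns = R rAns + H i) \<and>
      t + 7 * min (R rS) cap + 12 * i \<le> 12 * length al + 7 * min (R' rS) cap \<and>
      (\<forall>x. x \<notin> {rI, rT, rA, rS, rJ, rAns} \<longrightarrow> R' x = R x)"], goal_cases)
    case (3 i t R' M')
    then have i: "i < length al" by simp
    show ?case
    proof (cases "sel (al ! i)")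
      case False
      then show ?thesis
        using 3 assms(1-9) i V[OF i] H[OF i] by (auto simp: pred_mod sel_def)
    next
      case sel: True
      have Si: "R rS + V (Suc i) + length bs < 2 ^ w"
        using VS[of i] V[OF i] sel \<open>S < 2 ^ w\<close> by simp
      show ?thesis
      \<comment> \<open>Within the budget, \<open>min\<close> grows by the full bucket size and so
        pays seven units per comparison; beyond it, only the constant 12 per vector is
        spent.\<close>
      proof (cases "R rS + V i \<le> cap")
        case True
        show ?thesis
          using 3 assms(1-9) i V[OF i] H[OF i] True sel Si g[of "al ! i"]
          apply (simp add: pred_mod sel_def)
          apply (rule wp_cons[OF wp_count_loop[where bs = bs]])
               apply (auto simp: g_eq)
          done
      next
        case False
        then have "good \<Longrightarrow> g (al ! i) = length bs"
          using VS[of i] i sel by (auto simp: good_def)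
        moreover have "t + 7 * min (R rS) cap + 12 * Suc i \<le> 12 * length al + 7 * cap"
          using 3 min.cobounded2[of "R' rS" cap] by linarith
        ultimately show ?thesis
          using 3 assms(1-9) i V[OF i] H[OF i] False sel Si
          by (auto simp: pred_mod sel_def)
      qed
    qed
  next
    case (4 t R' M')
    then show ?case by (auto simp: V0 H_def)
  qed (use assms in \<open>auto simp: V_def H_def\<close>)
qed

section \<open>Summing over all prefixes\<close>

lemma sum_list_partition:
  fixes f :: "'a \<Rightarrow> nat" and g :: "'a \<Rightarrow> 'b :: comm_monoid_add"
  assumes "\<And>a. a \<in> set xs \<Longrightarrow> f a < K"
  shows "(\<Sum>p<K. \<Sum>a\<leftarrow>xs. if f a = p then g a else 0) = (\<Sum>a\<leftarrow>xs. g a)"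
  using assms by (induction xs) (simp_all add: sum.distrib)

text \<open>Truncating one of two orthogonal vectors keeps them orthogonal, so the bucket of a
  prefix misses no partner of a vector with that prefix.\<close>

lemma and_mask_zeroI:
  fixes a b m :: nat
  assumes "Bit_Operations.and a b = 0"
  shows "Bit_Operations.and b (Bit_Operations.and a m) = 0"
  using assms by (metis and.assoc and.commute and_zero_eq)

text \<open>The candidate pairs charged to the budget: each vector of the first list meets the
  bucket of its own prefix.\<close>

definition visits :: "nat \<Rightarrow> nat list \<Rightarrow> nat list \<Rightarrow> nat" where
  "visits m al bl =
    (\<Sum>a\<leftarrow>al. length (filter (\<lambda>b. Bit_Operations.and b (Bit_Operations.and a m) = 0) bl))"

definition hits :: "nat list \<Rightarrow> nat list \<Rightarrow> nat" where
  "hits al bl = (\<Sum>a\<leftarrow>al. length (filter (\<lambda>b. Bit_Operations.and a b = 0) bl))"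

lemma visits_le: "visits m al bl \<le> length al * length bl"
  unfolding visits_def by (induction al) (simp_all add: add_mono)

text \<open>Filling the bucket and scanning the first list cost linear time per prefix. The
  comparisons are charged to the growth of the minimum of \<open>rS\<close> and \<open>cap\<close>,
  which telescopes over all prefixes to at most \<open>cap\<close>.\<close>

lemma wp_prefix_loop:
  fixes al bl :: "nat list"
  assumes "R rOne = 1" "R rN = n" "length al = n" "length bl = n" "R rCap = Suc cap"
    and memA: "\<And>i. i < n \<Longrightarrow> M (R rX + i) = al ! i"
    and memB: "\<And>i. i < n \<Longrightarrow> M (R rB + i) = bl ! i"
    and "R rX + n \<le> R rB" "R rB + n \<le> R rY" "R rY + n < 2 ^ w" "n * n < 2 ^ w"
    and "R rAns = 0" "R rS = 0" "R rP < 2 ^ w"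
    and mask: "\<And>a. a \<in> set al \<Longrightarrow> Bit_Operations.and a (R rMask) < R rP"
  shows "wp w prefix_loop (\<lambda>t R' M'. t \<le> (21 * n + 7) * R rP + 7 * cap + 1 \<and>
    (visits (R rMask) al bl \<le> cap \<or> (\<forall>a \<in> set al. Bit_Operations.and a (R rMask) = a) \<longrightarrow>
      R' rAns = hits al bl)) R M"
proof -
  define K where "K = R rP"
  define m where "m = R rMask"
  define pre where "pre a = Bit_Operations.and a m" for a
  define v where "v a = length (filter (\<lambda>b. Bit_Operations.and b (pre a) = 0) bl)" for a
  define h where "h a = length (filter (\<lambda>b. Bit_Operations.and a b = 0) bl)" for a
  define V where "V p = (\<Sum>a\<leftarrow>al. if pre a = p then v a else 0)" for p
  define H where "H p = (\<Sum>a\<leftarrow>al. if pre a = p then h a else 0)" for p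
  define good where "good \<longleftrightarrow> visits m al bl \<le> cap \<or> (\<forall>a \<in> set al. pre a = a)"
  \<comment> \<open>Every vector of the first list has exactly one prefix, so the sums over prefixes
    regroup into sums over the list.\<close>
  have sumV: "sum V {..<K} = visits m al bl"
    unfolding V_def visits_def v_def pre_def using mask
    by (intro sum_list_partition) (simp add: m_def K_def)
  have sumH: "sum H {..<K} = hits al bl"
    unfolding H_def hits_def h_def pre_def using mask
    by (intro sum_list_partition) (simp add: m_def K_def)
  have part: "sum V {i..<K} \<le> visits m al bl" for i
    unfolding sumV[symmetric] by (rule sum_mono2) auto
  have vis: "visits m al bl < 2 ^ w"
    using visits_le[of m al bl] assms(3,4,11) by simp
  have wp: "wp w prefix_loop (\<lambda>t R' M'. t \<le> (21 * n + 7) * K + 7 * cap + 1 \<and>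
      (good \<longrightarrow> R' rAns = hits al bl)) R M"
    unfolding prefix_loop_def
  proof (rule wp_While[where m = K and I = "\<lambda>i t R' M'. i \<le> K \<and> R' rP = i \<and>
      R' rS = sum V {i..<K} \<and> R' rAns \<le> R' rS \<and> (good \<longrightarrow> R' rAns = sum H {i..<K}) \<and>
      t + (21 * n + 7) * i \<le> (21 * n + 7) * K + 7 * min (R' rS) cap \<and>
      (\<forall>a < R rY. M' a = M a) \<and>
      (\<forall>x \<in> {rOne, rN, rCap, rX, rB, rY, rMask}. R' x = R x)"], goal_cases)
    case (3 i t R' M')
    then have i: "i < K" by simp
    define bs where "bs = rev (filter (\<lambda>b. Bit_Operations.and b i = 0) bl)"
    have lbs: "length bs \<le> n" unfolding bs_def using length_filter_le[of _ bl] assms(4) by simp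
    have V: "sum V {i..<K} = sum V {Suc i..<K} + (\<Sum>a\<leftarrow>al. if pre a = i then length bs else 0)"
    proof -
      have "V i = (\<Sum>a\<leftarrow>al. if pre a = i then length bs else 0)"
        unfolding V_def v_def bs_def by (intro arg_cong[of _ _ sum_list] map_cong) auto
      then show ?thesis using sum.atLeast_Suc_lessThan[OF i, of V] by simp
    qed
    have filt: "length (filter (\<lambda>b. Bit_Operations.and a b = 0) bs) = h a" if "pre a = i" for a
      using that and_mask_zeroI[of a _ m] unfolding bs_def h_def pre_def
      by (auto simp: rev_filter[symmetric] intro!: arg_cong[of _ _ length] filter_cong)
    have H: "sum H {i..<K} = sum H {Suc i..<K} + (\<Sum>a\<leftarrow>al. if pre a = i
        then length (filter (\<lambda>b. Bit_Operations.and a b = 0) bs) else 0)"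
    proof -
      have "H i = (\<Sum>a\<leftarrow>al. if pre a = i
          then length (filter (\<lambda>b. Bit_Operations.and a b = 0) bs) else 0)"
        unfolding H_def by (intro arg_cong[of _ _ sum_list] map_cong) (auto simp: filt)
      then show ?thesis using sum.atLeast_Suc_lessThan[OF i, of H] by simp
    qed
    \<comment> \<open>This derives the condition of \<open>wp_scan_loop\<close> for one prefix from
      the global one: partial sums are bounded by the total, and if masking changes nothing, the
      bucket test already is the orthogonality test.\<close>
    have gd: "sum V {i..<K} \<le> cap \<or>
        (\<forall>a \<in> set al. pre a = i \<longrightarrow> length (filter (\<lambda>b. Bit_Operations.and a b = 0) bs) = length bs)"
      if good
    proof (cases "visits m al bl \<le> cap")
      case True
      then show ?thesis using part[of i] by simp
    next
      case False
      then have "pre a = a" if "a \<in> set al" for a using that \<open>good\<close> by (auto simp: good_def)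
      then show ?thesis by (auto simp: bs_def and.commute)
    qed
    define R1 where "R1 = R'(rP := i, rM := 0, rJ := n)"
    have bucket: "wp w bucket_loop (\<lambda>t R' M''. t \<le> 9 * length bl + 1 \<and>
      R' rM = length bs \<and> (\<forall>q < length bs. M'' (R1 rY + q) = bs ! q) \<and> (\<forall>a < R1 rY. M'' a = M' a) \<and>
      (\<forall>x. x \<notin> {rJ, rT, rV, rM} \<longrightarrow> R' x = R1 x)) R1 M'"
      unfolding bs_def using wp_bucket_loop[of R1 bl M' w] 3 assms(1-11) by (simp add: R1_def)
    have scan: "wp w scan_loop (\<lambda>t R3 M3. M3 = M2 \<and> R3 rS = sum V {i..<K} \<and> R3 rAns \<le> sum V {i..<K} \<and>
        (good \<longrightarrow> R3 rAns = sum H {i..<K}) \<and>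
        t + 7 * min (sum V {Suc i..<K}) cap \<le> 12 * n + 7 * min (sum V {i..<K}) cap + 1 \<and>
        (\<forall>x. x \<notin> {rI, rT, rA, rS, rJ, rAns} \<longrightarrow> R3 x = R2 x)) R2 M2"
      if R2: "R2 rI = n" "R2 rM = length bs" "R2 rP = i" "R2 rS = R' rS" "R2 rAns = R' rAns"
        "\<forall>x \<in> {rOne, rN, rCap, rX, rB, rY, rMask}. R2 x = R x"
        "\<forall>q < length bs. M2 (R rY + q) = bs ! q" "\<forall>a < R rY. M2 a = M a" for R2 M2
    proof -
      have S: "R2 rS + (\<Sum>a\<leftarrow>al. if Bit_Operations.and a (R2 rMask) = R2 rP then length bs else 0)
          = sum V {i..<K}"
        using V 3 that by (simp add: pre_def m_def)
      have "wp w scan_loop (\<lambda>t R3 M3. M3 = M2 \<and> R3 rS = sum V {i..<K} \<and> R3 rAns \<le> sum V {i..<K} \<and>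
          (sum V {i..<K} \<le> cap \<or> (\<forall>a \<in> set al. Bit_Operations.and a (R2 rMask) = R2 rP \<longrightarrow>
            length (filter (\<lambda>b. Bit_Operations.and a b = 0) bs) = length bs) \<longrightarrow>
            R3 rAns = R2 rAns + (\<Sum>a\<leftarrow>al. if Bit_Operations.and a (R2 rMask) = R2 rP
              then length (filter (\<lambda>b. Bit_Operations.and a b = 0) bs) else 0)) \<and>
          t + 7 * min (R2 rS) cap \<le> 12 * length al + 7 * min (sum V {i..<K}) cap + 1 \<and>
          (\<forall>x. x \<notin> {rI, rT, rA, rS, rJ, rAns} \<longrightarrow> R3 x = R2 x)) R2 M2"
      proof (rule wp_scan_loop[of R2 al bs cap M2 w, unfolded S])
        show "sum V {i..<K} < 2 ^ w" using part[of i] vis by linarith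
        show "R2 rAns \<le> R2 rS" using that(4,5) 3 by simp
        show "R2 rY + length bs < 2 ^ w" using that(6) assms(10) lbs by simp
        show "R2 rX + length al < 2 ^ w" using that(6) assms(3,8-10) by simp
        fix j assume "j < length al"
        then show "M2 (R2 rX + j) = al ! j" using that(6,8) assms(3,8,9) memA[of j] by simp
      qed (use that(1-3,6,7) assms(1,3,5) in simp_all)
      then show ?thesis
      proof (rule wp_cons, goal_cases)
        case (1 u R3 M3)
        have "R3 rAns = sum H {i..<K}" if good
          using gd[OF \<open>good\<close>]
        proof
          assume "sum V {i..<K} \<le> cap"
          then show ?thesis using 1 \<open>good\<close> 3 H R2 by (simp add: pre_def m_def)
        next
          assume "\<forall>a \<in> set al. pre a = i \<longrightarrow>
            length (filter (\<lambda>b. Bit_Operations.and a b = 0) bs) = length bs"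
          then show ?thesis using 1 \<open>good\<close> 3 H R2 by (simp add: pre_def m_def)
        qed
        then show ?case using 1 3 assms(3) R2 by simp
      qed
    qed
    \<comment> \<open>The 5 units are the four single instructions of the body and the loop
      test.\<close>
    have step: "wp w scan_loop (\<lambda>u R3 M3. i \<le> K \<and> R3 rP = i \<and>
        R3 rS = sum V {i..<K} \<and> R3 rAns \<le> R3 rS \<and> (good \<longrightarrow> R3 rAns = sum H {i..<K}) \<and>
        t + (v + u) + 5 + (21 * n + 7) * i \<le> (21 * n + 7) * K + 7 * min (R3 rS) cap \<and>
        (\<forall>a < R rY. M3 a = M a) \<and>
        (\<forall>x \<in> {rOne, rN, rCap, rX, rB, rY, rMask}. R3 x = R x)) (R2(rI := n)) M2"
      if v: "v \<le> 9 * length bl + 1" "R2 rM = length bs" "\<forall>q < length bs. M2 (R1 rY + q) = bs ! q"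
        "\<forall>a < R1 rY. M2 a = M' a" "\<forall>x. x \<notin> {rJ, rT, rV, rM} \<longrightarrow> R2 x = R1 x" for v R2 M2
    proof (rule wp_cons[OF scan], goal_cases)
      case (9 u R3 M3)
      have "t + (21 * n + 7) * Suc i \<le> (21 * n + 7) * K + 7 * min (sum V {Suc i..<K}) cap"
        using 3 by (auto simp del: mult_Suc_right)
      moreover have "(21 * n + 7) * Suc i = (21 * n + 7) * i + 21 * n + 7" by simp
      moreover have "u + 7 * min (sum V {Suc i..<K}) cap \<le> 12 * n + 7 * min (R3 rS) cap + 1"
        using 9 by simp
      ultimately have "t + (v + u) + 5 + (21 * n + 7) * i \<le> (21 * n + 7) * K + 7 * min (R3 rS) cap"
        using v(1) assms(4) by linarith
      then show ?case using 9 3 v i by (simp add: R1_def)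
    qed (use 3 v in \<open>simp_all add: R1_def\<close>)
    have "(n::nat) < 2 ^ w" "i < 2 ^ w" "Suc i < 2 ^ w" using assms(10,14) i by (simp_all add: K_def)
    then show ?case
      using 3 assms(1,2)
      apply (simp add: pred_mod)
      apply (rule wp_cons[OF bucket[unfolded R1_def]])
      subgoal for v R2 M2
        apply simp
        apply (rule wp_cons[OF step[of v R2 M2]])
             apply (simp_all add: R1_def)
        apply (elim conjE, simp)
        done
      done
  next
    case (4 t R' M')
    then show ?case using sumH by (auto simp: atLeast0LessThan)
  qed (use assms in \<open>auto simp: K_def\<close>)
  then show ?thesis by (simp add: K_def m_def good_def pre_def)
qed

section \<open>Memory layout, word size and the whole program\<close>

lemma length_concat_uniform:
  "(\<And>v. v \<in> set V \<Longrightarrow> length v = d) \<Longrightarrow> length (concat V) = length V * d"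
  by (induction V) auto

lemma concat_nth_uniform:
  assumes "\<And>v. v \<in> set V \<Longrightarrow> length v = d" "i < length V" "s < d"
  shows "concat V ! (i * d + s) = V ! i ! s"
  using assms
proof (induction V arbitrary: i)
  case (Cons v V)
  then show ?case by (cases i) (auto simp: nth_append)
qed simp

text \<open>A word has at least \<open>(C + 2) * F\<close> bits. Already \<open>2 * F\<close> bits
  hold \<open>N * N\<close>, which covers addresses and pair counts, and \<open>C * F\<close> stays
  below \<open>w\<close>, so a vector of \<open>C * floorlog 2 n\<close> coordinates fits.\<close>

lemma word_bounds:
  fixes n c C d :: nat
  assumes "n \<ge> 1" "c \<ge> C + 2"
  defines "w \<equiv> word_length c n d"
  shows "C * floorlog 2 n < w" "floorlog 2 n < w" "C < 2 ^ w" "(2::nat) < 2 ^ w"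
    "2 + 2 * n * d + 3 * n < 2 ^ w" "Suc (n * n) < 2 ^ w"
proof -
  define N where "N = 2 * (n + 1) * (d + 1)"
  define F where "F = floorlog 2 N"
  have N: "N = 2 * n * d + 2 * n + 2 * d + 2" by (simp add: N_def algebra_simps)
  have "N < 2 ^ F" unfolding F_def using floorlog_bounds[of N 2] N by simp
  then have "N * N < 2 ^ F * 2 ^ F" by (intro mult_strict_mono) auto
  also have "\<dots> = 2 ^ (2 * F)" by (simp add: mult_2 power_add)
  also have "2 * F \<le> w" unfolding w_def word_length_def F_def N_def using assms(2) by (intro mult_right_mono) auto
  then have "(2::nat) ^ (2 * F) \<le> 2 ^ w" by simp
  finally have NN: "N * N < 2 ^ w" .
  have "2 * N \<le> N * N" using N by (intro mult_right_mono) auto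
  then show "2 + 2 * n * d + 3 * n < 2 ^ w" "2 < (2::nat) ^ w" using NN N assms(1) by linarith+
  have "(n + 1) * (n + 1) \<le> N * N" using N by (intro mult_mono) auto
  then show "Suc (n * n) < 2 ^ w" using NN by simp
  have "floorlog 2 n \<le> F" unfolding F_def using N by (intro floorlog_mono) simp
  moreover have "F \<ge> 1" unfolding F_def using N by (simp add: floorlog_def)
  moreover have w: "(C + 2) * F \<le> w" unfolding w_def word_length_def F_def N_def using assms(2) by (intro mult_right_mono) auto
  ultimately have "C * floorlog 2 n \<le> C * F" "floorlog 2 n + C * F < w" "C * 1 \<le> C * F" "C * F < w"
    by (auto simp: algebra_simps)
  then show "C * floorlog 2 n < w" "floorlog 2 n < w" "C < 2 ^ w"
    using less_exp[of w] by linarith+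
qed

definition prefix_bits :: "nat \<Rightarrow> nat" where
  "prefix_bits n = floorlog 2 n div 2"

text \<open>The divisor is a power of two, so a shift computes the quotient; up to a constant factor
  it is \<open>n powr (1 / (2 * r))\<close>, the factor saved over quadratic time.\<close>

definition budget :: "nat \<Rightarrow> nat \<Rightarrow> nat" where
  "budget r n = n * n div 2 ^ (prefix_bits n div r)"

text \<open>\<open>C * floorlog 2 n\<close> stands for \<open>d\<close>, because larger dimensions
  stop before the encoding; thus the bound depends on \<open>n\<close> alone.\<close>

definition ov_time :: "nat \<Rightarrow> nat \<Rightarrow> nat \<Rightarrow> nat" where
  "ov_time C r n = 3 * floorlog 2 n + 26 + (6 * (C * floorlog 2 n) + 9) * (2 * n) +
    (21 * n + 7) * 2 ^ prefix_bits n + 7 * budget r n"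

lemma wp_ov_prog:
  assumes n: "n \<ge> 1" and c: "c \<ge> C + 2" and r: "r \<le> C"
    and I: "(A, B) \<in> ov_instances n d"
  defines "w \<equiv> word_length c n d" and "L \<equiv> floorlog 2 n" and "k \<equiv> prefix_bits n"
  defines "M \<equiv> snd (load_input (ov_input n d (A, B)))"
  shows "wp w (ov_prog C r) (\<lambda>t R' M'. t \<le> ov_time C r n \<and> (C * L < d \<longrightarrow> R' rAns = 0) \<and>
     (d \<le> C * L \<and> (visits (mask k) (map code A) (map code B) \<le> budget r n \<or> d \<le> k) \<longrightarrow>
       R' rAns = hits (map code A) (map code B))) (\<lambda>_. 0) M"
proof -
  define V where "V = A @ B"
  have lens: "length A = n" "length B = n" "\<And>v. v \<in> set V \<Longrightarrow> length v = d"
    using I by (auto simp: ov_instances_def Let_def V_def)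
  have lenV: "length V = 2 * n" using lens by (simp add: V_def)
  have M01: "M 0 = n" "M (Suc 0) = d"
    by (simp_all add: M_def load_input_def ov_input_def)
  have M: "M (2 + i * d + s) = of_bool (V ! i ! s)" if "i < length V" "s < d" for i s
  proof -
    have "Suc i * d \<le> length V * d" using that by (intro mult_right_mono) auto
    then have lt: "i * d + s < length (concat V)"
      using length_concat_uniform[of V d] lens(3) that by simp
    have "concat V ! (i * d + s) = V ! i ! s"
      using concat_nth_uniform[of V d i s] lens(3) that by simp
    then show ?thesis
      using lt nth_map[OF lt, of "of_bool :: bool \<Rightarrow> nat"]
      by (simp add: M_def load_input_def ov_input_def V_def)
  qed
  note wb = word_bounds[OF n c, of d, folded w_def L_def]
  have "k \<le> L" by (simp add: k_def L_def prefix_bits_def)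
  then have k: "k < w" using wb by linarith
  have Lw: "L < 2 ^ w" using wb(2) less_exp[of w] by linarith
  have log: "wp w log_loop (\<lambda>t R' M'. M' = M \<and> t = 3 * L + 1 \<and> R' rL = L \<and>
     (\<forall>x. x \<notin> {rU, rL} \<longrightarrow> R' x = R x)) R M"
    if "R rOne = 1" "R rL = 0" "R rU = n" for R
    using wp_log_loop[of R w M] that Lw by (simp add: L_def)
  have main: "wp w (init_com r ;; encode_loop ;; Op OpShl rP rOne rK ;; prefix_loop)
      (\<lambda>t R' M'. t \<le> 17 + (6 * d + 9) * (2 * n) + (21 * n + 7) * 2 ^ k + 7 * budget r n \<and>
       (visits (mask k) (map code A) (map code B) \<le> budget r n \<or> d \<le> k \<longrightarrow>
       R' rAns = hits (map code A) (map code B))) R M"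
    if R: "R rAns = 0" "R rS = 0" "R rOne = 1" "R rN = n" "R rD = d" "R rL = L" and d: "d \<le> C * L" for R
  proof -
    have nn: "n * n div 2 ^ (k div r) < 2 ^ w" "Suc (n * n div 2 ^ (k div r)) < 2 ^ w"
      using wb(6) div_le_dividend[of "n * n" "2 ^ (k div r)"] by linarith+
    define R1 where "R1 = R(rTwo := 2, rK := k, rMask := mask k, rT := k div r, rCap := Suc (budget r n),
      rI := 2 * n, rX := 2 + 2 * n * d, rB := 2 + 2 * n * d + n, rY := 2 + 2 * n * d + 2 * n)"
    \<comment> \<open>As \<open>r\<close> is at most \<open>C\<close>, the literal \<open>r\<close>
      is loaded without reduction.\<close>
    have rw: "r mod 2 ^ w = r" using wb(3) r by simp
    have "(2::nat) ^ k < 2 ^ w" using k by simp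
    have m1: "(2 ^ k + 2 ^ w - Suc 0) mod 2 ^ w = 2 ^ k - Suc 0"
    proof -
      have "(2::nat) ^ k + 2 ^ w - Suc 0 = 2 ^ k - Suc 0 + 2 ^ w" by simp
      moreover have "(2::nat) ^ k - Suc 0 < 2 ^ w" using \<open>2 ^ k < 2 ^ w\<close> by linarith
      ultimately show ?thesis by (simp only: mod_add_self2 mod_less)
    qed
    have m2: "(n + n) * d mod 2 ^ w = 2 * n * d" using wb(5) by (simp add: mult_2)
    have init: "wp w (init_com r) (\<lambda>t R' M'. t = 14 \<and> R' = R1 \<and> M' = M) R M"
      unfolding init_com_def R1_def
      using R wb rw nn \<open>2 ^ k < 2 ^ w\<close>
      by (simp add: k_def[unfolded prefix_bits_def, folded L_def, symmetric] drop_bit_eq_div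
          push_bit_eq_mult budget_def mask_eq_exp_minus_1 fun_eq_iff m1 m2 flip: k_def)
    have enc: "wp w encode_loop (\<lambda>t R' M'. t = (6 * d + 9) * (2 * n) + 1 \<and>
      (\<forall>i < n. M' (2 + 2 * n * d + i) = code (A ! i)) \<and>
      (\<forall>i < n. M' (2 + 2 * n * d + n + i) = code (B ! i)) \<and>
      (\<forall>x. x \<notin> {rI, rP, rV, rJ, rT} \<longrightarrow> R' x = R1 x)) R1 M"
    proof (rule wp_cons[OF wp_encode_loop[where V = V]], goal_cases)
      case (9 t R' M')
      then have *: "M' (2 + 2 * n * d + i) = code (V ! i)" if "i < 2 * n" for i
        using that lenV by (simp add: R1_def)
      have "M' (2 + 2 * n * d + i) = code (A ! i)" "M' (2 + 2 * n * d + n + i) = code (B ! i)"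
        if "i < n" for i
        using *[of i] *[of "n + i"] that lens by (simp_all add: V_def nth_append add.assoc)
      then show ?case using 9 lenV R by (simp add: R1_def)
    qed (use R lenV lens(3) wb d M in \<open>auto simp: R1_def\<close>)
    have pre: "wp w prefix_loop (\<lambda>t R' M'. t \<le> (21 * n + 7) * 2 ^ k + 7 * budget r n + 1 \<and>
       (visits (mask k) (map code A) (map code B) \<le> budget r n \<or> d \<le> k \<longrightarrow>
       R' rAns = hits (map code A) (map code B))) (R2(rP := 2 ^ k)) M2"
      if "\<forall>i < n. M2 (2 + 2 * n * d + i) = code (A ! i)"
        "\<forall>i < n. M2 (2 + 2 * n * d + n + i) = code (B ! i)"
        "\<forall>x. x \<notin> {rI, rP, rV, rJ, rT} \<longrightarrow> R2 x = R1 x" for R2 M2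
    proof (rule wp_cons[OF wp_prefix_loop[where n = n and al = "map code A" and bl = "map code B"
          and cap = "budget r n"]], goal_cases)
      case (15 a)
      then show ?case using that by (simp add: R1_def flip: take_bit_eq_mask)
    next
      case (16 t R' M')
      \<comment> \<open>A vector of at most \<open>k\<close> coordinates is its own prefix, which is
        the second alternative of \<open>wp_prefix_loop\<close>.\<close>
      have "take_bit k (code v) = code v" if "v \<in> set A" "d \<le> k" for v
      proof -
        have "code v < 2 ^ d" using code_less[of v] lens(3)[of v] that by (simp add: V_def)
        also have "(2::nat) ^ d \<le> 2 ^ k" using that by simp
        finally show ?thesis by (simp add: take_bit_nat_eq_self_iff)
      qed
      then show ?case using 16 that by (auto simp: R1_def simp flip: take_bit_eq_mask)
    qed (use that R wb lens \<open>2 ^ k < 2 ^ w\<close> in \<open>simp_all add: R1_def\<close>)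
    show ?thesis
      apply simp
      apply (rule wp_cons[OF init])
      apply simp
      apply (rule wp_cons[OF enc])
      subgoal for u R2 M2
        using \<open>2 ^ k < 2 ^ w\<close> R
        apply (simp add: R1_def)
        apply (rule wp_cons[OF pre[of M2 R2]])
           apply (simp_all add: R1_def)
        done
      done
  qed
  define P where "P = init_com r ;; encode_loop ;; Op OpShl rP rOne rK ;; prefix_loop"
  have CL: "C * L mod 2 ^ w = C * L" using less_trans[OF wb(1) less_exp] by simp
  show ?thesis
    unfolding ov_prog_def P_def[symmetric]
  proof (insert wb(1) M01, simp, rule wp_cons[OF log], goal_cases)
    case (4 t R' M')
    show ?case
    proof (cases "C * L < d")
      case True
      then show ?thesis using 4 wb(3) CL by (simp add: ov_time_def flip: L_def)
    next
      case False
      then have "(6 * d + 9) * (2 * n) \<le> (6 * (C * L) + 9) * (2 * n)"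
        by (intro mult_right_mono) auto
      then have T: "3 * L + 9 + (17 + (6 * d + 9) * (2 * n) + (21 * n + 7) * 2 ^ k + 7 * budget r n)
          \<le> ov_time C r n"
        unfolding ov_time_def L_def[symmetric] k_def[symmetric] by linarith
      have "wp w P (\<lambda>u R'' M''. 3 * L + 9 + u \<le> ov_time C r n \<and>
          (visits (mask k) (map code A) (map code B) \<le> budget r n \<or> d \<le> k \<longrightarrow>
          R'' rAns = hits (map code A) (map code B))) (R'(rT := 0)) M"
        unfolding P_def by (rule wp_cons[OF main]) (use 4 False T in auto)
      then show ?thesis using 4 wb(3) CL False by (auto elim!: wp_cons)
    qed
  qed simp_all
qed

section \<open>Orthogonal pairs in random lists\<close>

lemma map_nth_replicate_pmf:
  assumes "i < n"
  shows "map_pmf (\<lambda>xs. xs ! i) (replicate_pmf n p) = p"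
  using assms
proof (induction n arbitrary: i)
  case (Suc n)
  then show ?case
    by (cases i) (simp_all add: map_bind_pmf map_pmf_comp bind_return_pmf' flip: map_pmf_def)
qed simp

text \<open>Splits off the first coordinates of both vectors together, so that an induction on the
  dimension meets one pair of independent bits at a time.\<close>

lemma pair_replicate_pmf_Suc:
  "pair_pmf (replicate_pmf (Suc d) p) (replicate_pmf (Suc d) p') =
    map_pmf (\<lambda>((x, y), (u, v)). (x # u, y # v))
      (pair_pmf (pair_pmf p p') (pair_pmf (replicate_pmf d p) (replicate_pmf d p')))"
  unfolding pair_pmf_def map_pmf_def
  by (simp add: bind_assoc_pmf bind_return_pmf bind_commute_pmf[of "replicate_pmf d p" p'])

lemma prob_prefix_orthogonal:
  fixes \<mu> :: real
  assumes "0 \<le> \<mu>" "\<mu> \<le> 1" "k \<le> d"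
  defines "D \<equiv> replicate_pmf d (bernoulli_pmf \<mu>)"
  shows "measure_pmf.prob (pair_pmf D D) {(u, v). \<forall>s<k. \<not> (u ! s \<and> v ! s)} = (1 - \<mu>\<^sup>2) ^ k"
  using assms(3) unfolding D_def
proof (induction d arbitrary: k)
  case 0
  then show ?case by simp
next
  case (Suc d)
  show ?case
  proof (cases k)
    case (Suc k')
    let ?B = "bernoulli_pmf \<mu>"
    have "measure_pmf.prob (pair_pmf ?B ?B) {(x, y). \<not> (x \<and> y)} =
        measure_pmf.prob (pair_pmf ?B ?B) (space (measure_pmf (pair_pmf ?B ?B)) - {(True, True)})"
      by (intro arg_cong[of _ _ "measure_pmf.prob _"]) auto
    also have "\<dots> = 1 - measure_pmf.prob (pair_pmf ?B ?B) {(True, True)}"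
      by (rule measure_pmf.prob_compl) simp
    also have "\<dots> = 1 - \<mu>\<^sup>2"
      using assms by (simp add: measure_pmf_single pmf_pair power2_eq_square)
    finally have 1: "measure_pmf.prob (pair_pmf ?B ?B) {(x, y). \<not> (x \<and> y)} = 1 - \<mu>\<^sup>2" .
    \<comment> \<open>The event is a product of an event on the heads and one on the tails, so
      independence multiplies their probabilities.\<close>
    have "(\<lambda>((x, y), (u, v)). (x # u, y # v)) -` {(u, v). \<forall>s<k. \<not> (u ! s \<and> v ! s)} =
        {(x, y). \<not> (x \<and> y)} \<times> {(u, v). \<forall>s<k'. \<not> (u ! s \<and> v ! s)}"
      by (auto simp: Suc All_less_Suc2)
    then show ?thesis
      using Suc.prems Suc.IH[of k'] 1 Suc
      by (simp only: pair_replicate_pmf_Suc measure_map_pmf measure_pmf_prob_product countableI_type)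
        simp
  qed simp
qed

text \<open>The expected count is the sum of the probabilities by linearity, so dependence between
  the events, such as that of pairs sharing a vector, does no harm.\<close>

lemma markov_count:
  fixes p :: "'a pmf" and c :: real
  assumes "finite J" "c > 0"
  shows "measure_pmf.prob p {x. c \<le> real (card {j \<in> J. P j x})} \<le>
    (\<Sum>j\<in>J. measure_pmf.prob p {x. P j x}) / c"
proof -
  define f where "f x = (\<Sum>j\<in>J. indicator {x. P j x} x :: real)" for x
  have f: "f x = real (card {j \<in> J. P j x})" for x
    using assms(1) by (simp add: f_def indicator_def sum.If_cases Int_def)
  have f0: "f x \<ge> 0" for x by (simp add: f)
  have ind: "integrable (measure_pmf p) (indicat_real {x. P j x})" for j
    by (intro measure_pmf.integrable_const_bound[where B = 1]) auto
  then have "integrable (measure_pmf p) f"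
    unfolding f_def by (intro Bochner_Integration.integrable_sum)
  then have "measure_pmf.prob p {x \<in> space (measure_pmf p). c \<le> f x} \<le> measure_pmf.expectation p f / c"
    using assms f0 by (intro integral_Markov_inequality_measure[where A = UNIV]) auto
  also have "measure_pmf.expectation p f = (\<Sum>j\<in>J. measure_pmf.prob p {x. P j x})"
    unfolding f_def using ind by (subst Bochner_Integration.integral_sum) auto
  finally show ?thesis by (simp add: f)
qed

text \<open>One count for two purposes: \<open>k = d\<close> gives the answer, the prefix length
  gives the number of candidates.\<close>

definition orth_pairs :: "nat \<Rightarrow> nat \<Rightarrow> bvec list \<Rightarrow> bvec list \<Rightarrow> nat" where
  "orth_pairs n k A B = card {(i, j) \<in> {..<n} \<times> {..<n}. \<forall>s<k. \<not> (A ! i ! s \<and> B ! j ! s)}"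

lemma prob_orth_pairs:
  fixes \<mu> c :: real
  assumes "0 \<le> \<mu>" "\<mu> \<le> 1" "k \<le> d" "c > 0"
  shows "measure_pmf.prob (random_ov \<mu> n d) {(A, B). c \<le> real (orth_pairs n k A B)} \<le>
    real n ^ 2 * (1 - \<mu>\<^sup>2) ^ k / c"
proof -
  let ?D = "replicate_pmf d (bernoulli_pmf \<mu>)"
  define P where "P = (\<lambda>(i, j) (A :: bvec list, B :: bvec list). \<forall>s<k. \<not> (A ! i ! s \<and> B ! j ! s))"
  have 1: "measure_pmf.prob (random_ov \<mu> n d) {x. P ij x} = (1 - \<mu>\<^sup>2) ^ k"
    if mem: "ij \<in> {..<n} \<times> {..<n}" for ij
  proof -
    obtain i j where ij: "ij = (i, j)" "i < n" "j < n" using mem by auto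
    \<comment> \<open>The two lists are independent, so any choice of positions yields two
      independent random vectors.\<close>
    have "map_pmf (\<lambda>(A, B). (A ! i, B ! j)) (random_ov \<mu> n d) = pair_pmf ?D ?D"
      using ij by (simp add: random_ov_def Let_def map_pair map_nth_replicate_pmf)
    then have "measure_pmf.prob (pair_pmf ?D ?D) {(u, v). \<forall>s<k. \<not> (u ! s \<and> v ! s)} =
        measure_pmf.prob (random_ov \<mu> n d)
          ((\<lambda>(A, B). (A ! i, B ! j)) -` {(u, v). \<forall>s<k. \<not> (u ! s \<and> v ! s)})"
      by (metis measure_map_pmf)
    also have "(\<lambda>(A, B). (A ! i, B ! j)) -` {(u, v). \<forall>s<k. \<not> (u ! s \<and> v ! s)} = {x. P ij x}"
      by (auto simp: P_def ij)
    finally show ?thesis using prob_prefix_orthogonal[OF assms(1-3)] by simp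
  qed
  have "orth_pairs n k A B = card {ij \<in> {..<n} \<times> {..<n}. P ij (A, B)}" for A B
    unfolding orth_pairs_def P_def by (intro arg_cong[of _ _ card]) auto
  then have "{(A, B). c \<le> real (orth_pairs n k A B)} =
      {x. c \<le> real (card {ij \<in> {..<n} \<times> {..<n}. P ij x})}" by auto
  then show ?thesis
    using markov_count[of "{..<n} \<times> {..<n}" c "random_ov \<mu> n d" P] 1 assms(4)
    by (simp add: power2_eq_square)
qed

section \<open>Machine counts as numbers of orthogonal pairs\<close>

lemma sum_list_count_pairs:
  "(\<Sum>a\<leftarrow>al. length (filter (P a) bl)) =
    card {(i, j) \<in> {..<length al} \<times> {..<length bl}. P (al ! i) (bl ! j)}"
proof -
  have "{(i, j) \<in> {..<length al} \<times> {..<length bl}. P (al ! i) (bl ! j)} =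
      Sigma {..<length al} (\<lambda>i. {j. j < length bl \<and> P (al ! i) (bl ! j)})" by auto
  then show ?thesis
    by (simp add: sum_list_sum_nth length_filter_conv_card atLeast0LessThan)
qed

text \<open>Bit \<open>s\<close> of a code is coordinate \<open>s\<close>, so the conjunction marks
  the common ones, and the mask drops the coordinates from \<open>k\<close> on.\<close>

lemma orthogonal_iff_and_code:
  assumes "length u = d" "length v = d"
  shows "Bit_Operations.and (code u) (code v) = 0 \<longleftrightarrow> (\<forall>s<d. \<not> (u ! s \<and> v ! s))"
    and "k \<le> d \<Longrightarrow> Bit_Operations.and (code v) (Bit_Operations.and (code u) (mask k)) = 0 \<longleftrightarrow>
      (\<forall>s<k. \<not> (u ! s \<and> v ! s))"
proof -
  have eq: "x = 0 \<longleftrightarrow> (\<forall>s. \<not> bit x s)" for x :: nat by (simp add: bit_eq_iff)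
  show "Bit_Operations.and (code u) (code v) = 0 \<longleftrightarrow> (\<forall>s<d. \<not> (u ! s \<and> v ! s))"
    "k \<le> d \<Longrightarrow> Bit_Operations.and (code v) (Bit_Operations.and (code u) (mask k)) = 0 \<longleftrightarrow>
      (\<forall>s<k. \<not> (u ! s \<and> v ! s))"
    using assms by (auto simp: eq bit_simps)
qed

lemma counts_eq_orth_pairs:
  assumes "(A, B) \<in> ov_instances n d"
  shows "sharp_OV A B = orth_pairs n d A B" "hits (map code A) (map code B) = orth_pairs n d A B"
    "k \<le> d \<Longrightarrow> visits (mask k) (map code A) (map code B) = orth_pairs n k A B"
proof -
  have len: "length A = n" "length B = n" "\<And>i. i < n \<Longrightarrow> length (A ! i) = d"
    "\<And>i. i < n \<Longrightarrow> length (B ! i) = d"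
    using assms by (auto simp: ov_instances_def Let_def)
  have "dot (A ! i) (B ! j) = 0 \<longleftrightarrow> (\<forall>s<d. \<not> (A ! i ! s \<and> B ! j ! s))" if "i < n" for i j
    using len(3)[OF that] by (auto simp: dot_def)
  then show "sharp_OV A B = orth_pairs n d A B"
    using len unfolding sharp_OV_def orth_pairs_def by (intro arg_cong[of _ _ card]) auto
  show "hits (map code A) (map code B) = orth_pairs n d A B"
    unfolding hits_def sum_list_count_pairs orth_pairs_def
    using len by (intro arg_cong[of _ _ card]) (auto simp: orthogonal_iff_and_code)
  show "visits (mask k) (map code A) (map code B) = orth_pairs n k A B" if "k \<le> d"
    unfolding visits_def sum_list_count_pairs orth_pairs_def
    using len that by (intro arg_cong[of _ _ card]) (auto simp: orthogonal_iff_and_code)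
qed

section \<open>Parameters\<close>

lemma floorlog2_bounds:
  assumes "n \<ge> 1"
  shows "real n \<le> 2 ^ floorlog 2 n" "2 ^ floorlog 2 n \<le> 2 * real n"
    "log 2 n \<le> real (floorlog 2 n)" "real (floorlog 2 n) \<le> log 2 n + 1"
proof -
  have "n < 2 ^ floorlog 2 n" "2 ^ (floorlog 2 n - 1) \<le> n"
    using floorlog_bounds[of n 2] assms by auto
  moreover have "floorlog 2 n \<ge> 1" using assms by (simp add: floorlog_def)
  then have "(2::nat) ^ floorlog 2 n = 2 * 2 ^ (floorlog 2 n - 1)"
    by (cases "floorlog 2 n") auto
  ultimately have "n \<le> 2 ^ floorlog 2 n" "2 ^ floorlog 2 n \<le> 2 * n" by linarith+
  then show 1: "real n \<le> 2 ^ floorlog 2 n" "2 ^ floorlog 2 n \<le> 2 * real n"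
    by (metis of_nat_le_iff of_nat_numeral of_nat_power of_nat_mult)+
  show "log 2 n \<le> real (floorlog 2 n)" 
    using 1(1) assms by (simp add: log_le_iff powr_realpow)
  have "real (floorlog 2 n) = log 2 (2 ^ floorlog 2 n)" by simp
  also have "\<dots> \<le> log 2 (2 * real n)" using 1(2) assms by (simp del: log_pow_cancel)
  also have "\<dots> = log 2 n + 1" using assms by (simp add: log_mult)
  finally show "real (floorlog 2 n) \<le> log 2 n + 1" .
qed

text \<open>Encoding costs about \<open>n * ln n\<close> and the loop over prefixes about
  \<open>n powr (3 / 2)\<close>; the budget dominates and determines the exponent.\<close>

lemma ov_time_soft_O:
  assumes "q \<ge> 1"
  shows "(\<lambda>n. real (ov_time C q n)) \<in> soft_O (\<lambda>n. real n powr (2 - 1 / (2 * real q)))"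
proof -
  define \<delta> where "\<delta> = 1 / (2 * real q)"
  have \<delta>: "0 < \<delta>" "\<delta> \<le> 1 / 2" using assms by (auto simp: \<delta>_def field_simps)
  \<comment> \<open>The four summands are the constants of \<open>T1\<close> to \<open>T4\<close>
    below.\<close>
  define K where "K = 35 + (18 * real C + 9) * 2 + 56 + 28"
  have "real (ov_time C q n) \<le> K * (real n powr (2 - \<delta>) * ln (real n) ^ 1)" if n: "n \<ge> 3" for n
  proof -
    define L where "L = floorlog 2 n"
    define k where "k = prefix_bits n"
    define j where "j = k div q"
    define g where "g = real n powr (2 - \<delta>)"
    have n1: "n \<ge> 1" "real n \<ge> 1" using n by auto
    note fl = floorlog2_bounds[OF n1(1), folded L_def]
    \<comment> \<open>From 3 on the logarithm is at least 1 and absorbs constants.\<close>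
    have "exp 1 \<le> real n" using n exp_le by linarith
    then have ln1: "ln (real n) \<ge> 1" using n by (simp add: ln_ge_iff)
    have "ln (2::real) \<ge> 1 / 2" using ln_le_minus_one[of "1 / 2 :: real"] by (simp add: ln_div)
    then have "ln (real n) \<le> ln (real n) * (2 * ln 2)" using ln1 by simp
    then have "log 2 n \<le> 2 * ln (real n)" by (simp add: log_def field_simps)
    then have L: "real L \<le> 3 * ln (real n)" using fl(4) ln1 by linarith
    have g1: "real n \<le> g"
      using powr_mono[of 1 "2 - \<delta>" "real n"] \<delta> n1 by (simp add: g_def)
    then have g: "g \<ge> 1" using n1 by linarith
    have gln: "g \<le> g * ln (real n)" "ln (real n) \<le> g * ln (real n)" "real n * ln (real n) \<le> g * ln (real n)"
      using g ln1 g1 by (simp_all add: mult_le_cancel_right1)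
    have T1: "3 * real L + 26 \<le> 35 * (g * ln (real n))"
      using L ln1 gln by linarith
    have "(6 * (real C * real L) + 9) \<le> (18 * real C + 9) * ln (real n)"
    proof -
      have "real C * real L \<le> real C * (3 * ln (real n))" using L by (intro mult_left_mono) auto
      then show ?thesis using ln1 by (simp add: algebra_simps)
    qed
    then have "(6 * (real C * real L) + 9) * (2 * real n) \<le> (18 * real C + 9) * ln (real n) * (2 * real n)"
      by (intro mult_right_mono) auto
    also have "\<dots> = (18 * real C + 9) * 2 * (real n * ln (real n))" by simp
    also have "\<dots> \<le> (18 * real C + 9) * 2 * (g * ln (real n))" using gln by (intro mult_left_mono) auto
    finally have T2: "(6 * (real C * real L) + 9) * (2 * real n) \<le> (18 * real C + 9) * 2 * (g * ln (real n))" .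
    have "((2::real) ^ k)\<^sup>2 \<le> 2 ^ L"
      unfolding power_mult[symmetric] by (intro power_increasing) (auto simp: k_def L_def prefix_bits_def)
    also have "\<dots> \<le> 4 * real n" using fl(2) by simp
    also have "\<dots> = (2 * real n powr (1 / 2))\<^sup>2"
      using n1 by (simp add: power_mult_distrib powr_half_sqrt)
    finally have k2: "(2::real) ^ k \<le> 2 * real n powr (1 / 2)"
      by (rule power2_le_imp_le) simp
    have "(21 * real n + 7) * 2 ^ k \<le> (28 * real n) * (2 * real n powr (1 / 2))"
      using k2 n1 by (intro mult_mono) auto
    also have "\<dots> = 56 * real n powr (1 + 1 / 2)" using n1 powr_add[of "real n" 1 "1 / 2"] by simp
    also have "\<dots> \<le> 56 * g"
      unfolding g_def using n1 \<delta> by (intro mult_left_mono powr_mono) auto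
    also have "\<dots> \<le> 56 * (g * ln (real n))" using gln by simp
    finally have T3: "(21 * real n + 7) * 2 ^ k \<le> 56 * (g * ln (real n))" .
    \<comment> \<open>Rounding in \<open>k\<close> and in \<open>j\<close> costs at most 2 in the
      exponent, hence the factor 4.\<close>
    have "real n powr \<delta> / 4 \<le> 2 ^ j"
    proof -
      have "2 * k + 1 \<ge> L" by (simp add: k_def L_def prefix_bits_def)
      then have "2 * real k + 1 \<ge> log 2 n" using fl(3) by linarith
      moreover have "k < q * (j + 1)" using assms by (simp add: j_def dividend_less_times_div)
      then have "real k \<le> real q * (real j + 1)"
        by (metis less_imp_le of_nat_1 of_nat_add of_nat_le_iff of_nat_mult)
      ultimately have "log 2 n \<le> 2 * (real q * (real j + 1)) + 1" by linarith
      then have "\<delta> * log 2 n \<le> \<delta> * (2 * (real q * (real j + 1)) + 1)"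
        using \<delta> by (intro mult_left_mono) auto
      also have "\<dots> = real j + 1 + \<delta>" using assms by (simp add: \<delta>_def field_simps)
      finally have "\<delta> * log 2 n \<le> real j + 2" using \<delta> by linarith
      then have "(2::real) powr (\<delta> * log 2 n) \<le> 2 powr (real j + 2)" by simp
      also have "\<dots> = 4 * 2 ^ j" by (simp add: powr_add powr_realpow)
      also have "(2::real) powr (\<delta> * log 2 n) = real n powr \<delta>"
        using n1 by (simp add: powr_def log_def)
      finally show ?thesis by simp
    qed
    then have "real n * real n * (real n powr \<delta> / 4) \<le> real n * real n * 2 ^ j"
      by (intro mult_left_mono) auto
    then have j: "real n * real n / 2 ^ j \<le> 4 * (real n * real n / real n powr \<delta>)"
      using n1 by (simp add: field_simps)
    have "real (budget q n) \<le> real n * real n / 2 ^ j"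
      unfolding budget_def k_def[symmetric] j_def[symmetric]
      using of_nat_div_le_of_nat[of "n * n" "2 ^ j"] by simp
    also note j
    also have "real n * real n / real n powr \<delta> = g"
      using n1 by (simp add: g_def powr_diff powr_numeral power2_eq_square)
    finally have T4: "7 * real (budget q n) \<le> 28 * (g * ln (real n))" using gln by linarith
    have "real (ov_time C q n) = (3 * real L + 26) + (6 * (real C * real L) + 9) * (2 * real n) +
        (21 * real n + 7) * 2 ^ k + 7 * real (budget q n)"
      by (simp add: ov_time_def L_def k_def)
    also have "\<dots> \<le> K * (g * ln (real n))"
      using T1 T2 T3 T4 by (simp add: K_def ring_distribs)
    finally show ?thesis by (simp add: g_def)
  qed
  then have "(\<lambda>n. real (ov_time C q n)) \<in> O(\<lambda>n. real n powr (2 - \<delta>) * ln (real n) ^ 1)"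
    by (intro bigoI[where c = K] eventually_sequentiallyI[of 3]) auto
  then show ?thesis unfolding soft_O_def \<delta>_def by blast
qed

text \<open>For large \<open>d\<close>, \<open>4 ^ L\<close> bounds the square of \<open>n\<close>
  up to rounding upwards and is cancelled by \<open>\<rho> ^ (q * L)\<close>, leaving
  \<open>\<rho> ^ L\<close>. For the prefix, \<open>4 ^ (k div q) * \<rho> ^ k \<le> 1\<close>
  bounds the square of the left side by \<open>\<rho> ^ k\<close>. The 6 in
  \<open>\<epsilon>\<close> pays a factor 2 for the square root and 3 for
  \<open>L \<le> 3 * k\<close>.\<close>

lemma failure_bounds:
  fixes \<rho> :: real
  assumes \<rho>: "0 < \<rho>" "\<rho> < 1" and q: "q \<ge> 1" "\<rho> ^ q \<le> 1 / 4" and n: "n \<ge> 2"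
  defines "\<epsilon> \<equiv> log 2 (1 / \<rho>) / 6" and "L \<equiv> floorlog 2 n" and "k \<equiv> prefix_bits n"
  shows "(q + 1) * L < d \<Longrightarrow> real n ^ 2 * \<rho> ^ d \<le> real n powr (- \<epsilon>)"
    and "2 ^ (k div q) * \<rho> ^ k \<le> real n powr (- \<epsilon>)"
proof -
  have \<epsilon>: "\<epsilon> > 0" using \<rho> by (simp add: \<epsilon>_def)
  have pow: "\<rho> ^ m = 2 powr (- 6 * \<epsilon> * real m)" for m
  proof -
    have "2 powr (- 6 * \<epsilon>) = \<rho>" using \<rho> by (simp add: \<epsilon>_def log_divide)
    then have "\<rho> ^ m = (2 powr (- 6 * \<epsilon>)) powr real m" using \<rho> by (simp add: powr_realpow)
    then show ?thesis by (simp only: powr_powr)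
  qed
  have nL: "2 powr (- \<epsilon> * real L) \<le> real n powr (- \<epsilon>)"
  proof -
    have "log 2 n * \<epsilon> \<le> real L * \<epsilon>"
      using floorlog2_bounds(3)[of n] n \<epsilon> by (intro mult_right_mono) (auto simp: L_def)
    then have "2 powr (- \<epsilon> * real L) \<le> 2 powr (- \<epsilon> * log 2 n)" by (simp add: mult.commute)
    also have "\<dots> = real n powr (- \<epsilon>)" using n by (simp add: powr_def log_def)
    finally show ?thesis .
  qed
  show "real n ^ 2 * \<rho> ^ d \<le> real n powr (- \<epsilon>)" if d: "(q + 1) * L < d"
  proof -
    have "real n ^ 2 * \<rho> ^ d \<le> (2 ^ L) ^ 2 * \<rho> ^ ((q + 1) * L)"
      using floorlog2_bounds(1)[of n] n \<rho> d
      by (intro mult_mono power_mono power_decreasing) (auto simp: L_def)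
    also have "\<dots> = (4 * \<rho> ^ q) ^ L * \<rho> ^ L"
    proof -
      have "((2::real) ^ L) ^ 2 = 4 ^ L"
        by (simp add: power2_eq_square flip: power_mult_distrib)
      moreover have "\<rho> ^ ((q + 1) * L) = (\<rho> ^ q) ^ L * \<rho> ^ L"
        by (simp add: power_add power_mult add_mult_distrib)
      ultimately show ?thesis by (simp only: power_mult_distrib mult.assoc)
    qed
    also have "\<dots> \<le> 1 * \<rho> ^ L"
      using q \<rho> by (intro mult_right_mono power_le_one) auto
    also have "\<dots> \<le> 2 powr (- \<epsilon> * real L)"
      using \<epsilon> by (simp add: pow)
    also note nL
    finally show ?thesis .
  qed
  \<comment> \<open>Now \<open>k\<close> is at least 1, so \<open>L \<le> 2 * k + 1\<close> gives
    \<open>L \<le> 3 * k\<close>.\<close>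
  have L2: "L \<ge> 2"
    unfolding L_def using n by (intro floorlog_geI) auto
  then have Lk: "L \<le> 3 * k" by (simp add: L_def k_def prefix_bits_def)
  have "\<rho> ^ k \<le> \<rho> ^ (q * (k div q))" using \<rho> by (intro power_decreasing) auto
  also have "\<dots> \<le> (1 / 4) ^ (k div q)" unfolding power_mult using q \<rho> by (intro power_mono) auto
  finally have "4 ^ (k div q) * \<rho> ^ k \<le> 1" by (simp add: power_one_over field_simps)
  then have "4 ^ (k div q) * \<rho> ^ k * \<rho> ^ k \<le> 1 * \<rho> ^ k" using \<rho> by (intro mult_right_mono) auto
  also have "4 ^ (k div q) * \<rho> ^ k * \<rho> ^ k = (2 ^ (k div q) * \<rho> ^ k)\<^sup>2"
    by (simp add: power_mult_distrib power2_eq_square flip: power_mult_distrib[of 2 2])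
  also have "1 * \<rho> ^ k = (2 powr (- 3 * \<epsilon> * real k))\<^sup>2"
    by (simp add: pow power2_eq_square mult.assoc flip: powr_add)
  finally have "2 ^ (k div q) * \<rho> ^ k \<le> 2 powr (- 3 * \<epsilon> * real k)"
    by (rule power2_le_imp_le) simp
  also have "real L * \<epsilon> \<le> 3 * real k * \<epsilon>" using Lk \<epsilon> by (intro mult_right_mono) linarith+
  then have "2 powr (- 3 * \<epsilon> * real k) \<le> 2 powr (- \<epsilon> * real L)" by (simp add: algebra_simps)
  also note nL
  finally show "2 ^ (k div q) * \<rho> ^ k \<le> real n powr (- \<epsilon>)" .
qed

section \<open>The theorem\<close>

lemma ov_prog_runs:
  assumes "n \<ge> 1" "c \<ge> C + 2" "r \<le> C" "(A, B) \<in> ov_instances n d"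
  defines "w \<equiv> word_length c n d" and "L \<equiv> floorlog 2 n" and "k \<equiv> prefix_bits n"
  shows "halts_within w (ov_prog C r) (ov_input n d (A, B)) (ov_time C r n)"
    and "(C * L < d \<and> orth_pairs n d A B = 0) \<or>
      (d \<le> C * L \<and> (d \<le> k \<or> orth_pairs n k A B \<le> budget r n)) \<Longrightarrow>
      outputs w (ov_prog C r) (ov_input n d (A, B)) (sharp_OV A B)"
proof -
  have load: "load_input xs = (\<lambda>_. 0, snd (load_input xs))" for xs
    by (simp add: load_input_def)
  obtain t R' M' where run: "exec w (ov_prog C r) (load_input (ov_input n d (A, B))) t (R', M')"
      "t \<le> ov_time C r n" "C * L < d \<longrightarrow> R' rAns = 0"
      "d \<le> C * L \<and> (visits (mask k) (map code A) (map code B) \<le> budget r n \<or> d \<le> k) \<longrightarrow>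
       R' rAns = hits (map code A) (map code B)"
    using wp_ov_prog[OF assms(1-4)] unfolding wp_def w_def L_def k_def load[symmetric] by blast
  show "halts_within w (ov_prog C r) (ov_input n d (A, B)) (ov_time C r n)"
    unfolding halts_within_def using run by blast
  assume "(C * L < d \<and> orth_pairs n d A B = 0) \<or>
      (d \<le> C * L \<and> (d \<le> k \<or> orth_pairs n k A B \<le> budget r n))"
  then have "R' rAns = sharp_OV A B"
    using run(3,4) counts_eq_orth_pairs[OF assms(4)] by (cases "d \<le> k") auto
  then show "outputs w (ov_prog C r) (ov_input n d (A, B)) (sharp_OV A B)"
    unfolding outputs_def using run(1) by fastforce
qed

lemma set_random_ov: "set_pmf (random_ov \<mu> n d) \<subseteq> ov_instances n d"
  by (auto simp: random_ov_def ov_instances_def Let_def set_replicate_pmf lists_eq_set subset_iff)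

lemma ov_prog_prob:
  fixes \<mu> :: real
  assumes \<mu>: "0 < \<mu>" "\<mu> < 1" and q: "q \<ge> 1" "(1 - \<mu>\<^sup>2) ^ q \<le> 1 / 4" and n: "n \<ge> 1"
  shows "measure_pmf.prob (random_ov \<mu> n d) {(A, B). outputs (word_length (q + 3) n d) (ov_prog (q + 1) q)
      (ov_input n d (A, B)) (sharp_OV A B)} \<ge> 1 - real n powr (- (log 2 (1 / (1 - \<mu>\<^sup>2)) / 6))"
\<comment> \<open>For \<open>n = 1\<close> the claimed lower bound is 0.\<close>
proof (cases "n = 1")
  case False
  define \<rho> where "\<rho> = 1 - \<mu>\<^sup>2"
  define \<epsilon> where "\<epsilon> = log 2 (1 / \<rho>) / 6"
  define k where "k = prefix_bits n"
  define Out where "Out = {(A, B). outputs (word_length (q + 3) n d) (ov_prog (q + 1) q)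
      (ov_input n d (A, B)) (sharp_OV A B)}"
  have \<rho>: "0 < \<rho>" "\<rho> < 1" using \<mu> by (auto simp: \<rho>_def power_less_one_iff abs_square_less_1)
  have n2: "n \<ge> 2" using n False by simp
  note fb = failure_bounds[OF \<rho> q(1) q(2)[folded \<rho>_def] n2, folded \<epsilon>_def k_def]
  note po = prob_orth_pairs[OF less_imp_le[OF \<mu>(1)] less_imp_le[OF \<mu>(2)], folded \<rho>_def]
  note runs = ov_prog_runs(2)[of n "q + 1" "q + 3" q _ _ d, folded k_def]
  obtain Bad where Bad: "measure_pmf.prob (random_ov \<mu> n d) Bad \<le> real n powr (- \<epsilon>)"
    and good: "\<And>A B. (A, B) \<in> ov_instances n d \<Longrightarrow> (A, B) \<notin> Bad \<Longrightarrow> (A, B) \<in> Out"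
  proof -
    consider "(q + 1) * floorlog 2 n < d" | "d \<le> (q + 1) * floorlog 2 n" "d \<le> k"
      | "d \<le> (q + 1) * floorlog 2 n" "k < d" by linarith
    then show ?thesis
    proof cases
      case 1
      show ?thesis
      proof (rule that)
        show "measure_pmf.prob (random_ov \<mu> n d) {(A, B). 1 \<le> real (orth_pairs n d A B)}
            \<le> real n powr (- \<epsilon>)"
          using po[of d d 1 n] fb(1)[OF 1] by simp
        show "(A, B) \<in> Out" if "(A, B) \<in> ov_instances n d"
          "(A, B) \<notin> {(A, B). 1 \<le> real (orth_pairs n d A B)}" for A B
          using runs[OF n _ _ that(1)] that(2) 1 by (simp add: Out_def)
      qed
    next
      case 2
      show ?thesis
      proof (rule that)
        \<comment> \<open>The prefix is the whole vector, so the program is correct on every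
          instance and no event is bad.\<close>
        show "measure_pmf.prob (random_ov \<mu> n d) {} \<le> real n powr (- \<epsilon>)" by simp
        show "(A, B) \<in> Out" if "(A, B) \<in> ov_instances n d" for A B
          using runs[OF n _ _ that] 2 by (simp add: Out_def)
      qed
    next
      case 3
      define c where "c = real n ^ 2 / 2 ^ (k div q)"
      have c: "c > 0" using n by (simp add: c_def)
      show ?thesis
      proof (rule that)
        have "real n ^ 2 * \<rho> ^ k / c = 2 ^ (k div q) * \<rho> ^ k" using n by (simp add: c_def field_simps)
        then show "measure_pmf.prob (random_ov \<mu> n d) {(A, B). c \<le> real (orth_pairs n k A B)}
            \<le> real n powr (- \<epsilon>)"
          using po[of k d c n] 3 c fb(2) by simp
        show "(A, B) \<in> Out" if "(A, B) \<in> ov_instances n d"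
          "(A, B) \<notin> {(A, B). c \<le> real (orth_pairs n k A B)}" for A B
        proof -
          \<comment> \<open>The count is an integer below the real quotient, hence at most its
            floor, the budget.\<close>
          have "real (orth_pairs n k A B) * 2 ^ (k div q) < real (n * n)"
            using that(2) by (simp add: c_def field_simps power2_eq_square)
          then have "orth_pairs n k A B * 2 ^ (k div q) \<le> n * n"
            by (metis less_imp_le of_nat_le_iff of_nat_mult of_nat_numeral of_nat_power)
          then have "orth_pairs n k A B \<le> budget q n"
            by (simp add: budget_def less_eq_div_iff_mult_less_eq flip: k_def)
          then show ?thesis using runs[OF n _ _ that(1)] 3 by (simp add: Out_def)
        qed
      qed
    qed
  qed
  have "1 - real n powr (- \<epsilon>) \<le> 1 - measure_pmf.prob (random_ov \<mu> n d) Bad" using Bad by simp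
  also have "\<dots> = measure_pmf.prob (random_ov \<mu> n d) (- Bad)"
    using measure_pmf.prob_compl[of Bad "random_ov \<mu> n d"] by (simp add: Compl_eq_Diff_UNIV)
  also have "\<dots> \<le> measure_pmf.prob (random_ov \<mu> n d) Out"
    using good set_random_ov[of \<mu> n d]
    by (intro measure_pmf.finite_measure_mono_AE) (auto simp: AE_measure_pmf_iff)
  finally show ?thesis by (simp add: Out_def \<epsilon>_def \<rho>_def)
qed simp

theorem theorem1p18:
  fixes \<mu> :: real and d :: "nat \<Rightarrow> nat"
  assumes "0 < \<mu>" and "\<mu> < 1"
  shows "\<exists>\<epsilon>>0. \<exists>\<delta>>0. \<exists>(P :: com) (c :: nat) (T :: nat \<Rightarrow> nat).
    c \<ge> 1 \<and>
    (\<lambda>n. real (T n)) \<in> soft_O (\<lambda>n. real n powr (2 - \<delta>)) \<and>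
    (\<forall>n\<ge>1.
      (\<forall>I \<in> ov_instances n (d n).
         halts_within (word_length c n (d n)) P (ov_input n (d n) I) (T n)) \<and>
      measure_pmf.prob (random_ov \<mu> n (d n))
        {(A, B). outputs (word_length c n (d n)) P (ov_input n (d n) (A, B)) (sharp_OV A B)}
        \<ge> 1 - real n powr (- \<epsilon>))"
proof -
  define \<rho> where "\<rho> = 1 - \<mu>\<^sup>2"
  have \<rho>: "0 < \<rho>" "\<rho> < 1" using assms by (auto simp: \<rho>_def power_less_one_iff abs_square_less_1)
  \<comment> \<open>The threshold 1/4 lets \<open>\<rho> ^ q\<close> cancel one factor 4 per bit of
    \<open>n\<close>; the shift to \<open>m + 1\<close> keeps \<open>q\<close> positive.\<close>
  obtain m where m: "\<rho> ^ m < 1 / 4" using real_arch_pow_inv[of "1 / 4" \<rho>] \<rho> by auto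
  define q where "q = m + 1"
  have "\<rho> ^ q \<le> \<rho> ^ m" unfolding q_def using \<rho> by (intro power_decreasing) auto
  with m have q: "q \<ge> 1" "\<rho> ^ q \<le> 1 / 4" by (simp_all add: q_def)
  have "log 2 (1 / \<rho>) / 6 > 0" using \<rho> by simp
  moreover have "1 / (2 * real q) > 0" using q by simp
  moreover have "halts_within (word_length (q + 3) n (d n)) (ov_prog (q + 1) q) (ov_input n (d n) I)
      (ov_time (q + 1) q n)" if "n \<ge> 1" "I \<in> ov_instances n (d n)" for n I
    using ov_prog_runs(1)[of n "q + 1" "q + 3" q "fst I" "snd I" "d n"] that by simp
  moreover note ov_time_soft_O[OF q(1), of "q + 1"]
  moreover note ov_prog_prob[OF assms q[unfolded \<rho>_def], folded \<rho>_def]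
  \<comment> \<open>All witnesses depend on \<open>\<mu>\<close> only, so the dimension may vary
    freely with \<open>n\<close>. The word factor \<open>q + 3\<close> is \<open>C + 2\<close> for
    \<open>C = q + 1\<close>.\<close>
  ultimately show ?thesis
    by (intro exI[of _ "log 2 (1 / \<rho>) / 6"] exI[of _ "1 / (2 * real q)"] exI[of _ "ov_prog (q + 1) q"]
        exI[of _ "q + 3"] exI[of _ "ov_time (q + 1) q"] conjI allI impI ballI) simp_all
qed

end
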